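(* Let $K_1,K_2\in\operatorname{End}_{\mathcal A}^*(\mathcal H)$ have closed ranges, and let $\{\Upsilon_\xi\}_{\xi\in\Omega}$ and $\{\Phi_\xi\}_{\xi\in\Omega}$ be, respectively, a c-$K_1$-g-frame and a c-g-Bessel sequence for $\mathcal H$ with respect to $\{\mathcal H_\xi\}_{\xi\in\Omega}$. (i) If $K_1\ge0$ and $\{\Phi_\xi\}_{\xi\in\Omega}$ is a c-$K_1$-g-dual for $\{\Upsilon_\xi\}_{\xi\in\Omega}$, then $\{\Upsilon_\xi+\Phi_\xi\}_{\xi\in\Omega}$ is a c-$K_1$-g-frame for $\mathcal H$ with respect to $\{\mathcal H_\xi\}_{\xi\in\Omega}$. (ii) If $\{\Phi_\xi\}_{\xi\in\Omega}$ is a c-$(K_1+K_2)$-g-frame for $\mathcal H$ with respect to $\{\mathcal H_\xi\}_{\xi\in\Omega}$ and $\mathcal T_\Upsilon\mathcal T_\Phi^*=0$, then $\{\Upsilon_\xi+\Phi_\xi\}_{\xi\in\Omega}$ is a c-$(K_1+K_2)$-g-frame for $\mathcal H$ with respect to $\{\mathcal H_\xi\}_{\xi\in\Omega}$.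
   Context: Standing setting: $\mathcal A$ is a unital $C^*$-algebra, $(\Omega,\nu)$ is a measure space, $\mathcal H$ and $\mathcal K$ are Hilbert $\mathcal A$-modules (with $\mathcal A$-valued inner products $\langle\cdot,\cdot\rangle$, linear in the first variable), and $\{\mathcal H_\xi\}_{\xi\in\Omega}$ is a family of (closed sub)modules of $\mathcal K$. $\operatorname{End}_{\mathcal A}^*(\mathcal E,\mathcal F)$ is the set of adjointable $\mathcal A$-linear maps $\mathcal E\to\mathcal F$, and $\operatorname{End}_{\mathcal A}^*(\mathcal E)=\operatorname{End}_{\mathcal A}^*(\mathcal E,\mathcal E)$. Inequalities between elements of $\mathcal A$ are in the order of the $C^*$-algebra, and $K_1\ge0$ means $K_1$ is a positive operator. For $K\in\operatorname{End}_{\mathcal A}^*(\mathcal H)$, a family $\{\Upsilon_\xi\in\operatorname{End}_{\mathcal A}^*(\mathcal H,\mathcal H_\xi)\}_{\xi\in\Omega}$ is a c-$K$-g-frame (continuous $K$-g-frame) for $\mathcal H$ with respect to $\{\mathcal H_\xi\}_{\xi\in\Omega}$ if (a) for every $h\in\mathcal H$ the function $\xi\mapsto\Upsilon_\xi h$ is measurable, and (b) there exist constants $0<A\le B<\infty$ such that for all $h\in\mathcal H$: $A\langle K^*h,K^*h\rangle\le\int_\Omega\langle\Upsilon_\xi h,\Upsilon_\xi h\rangle\,\mathrm d\nu(\xi)\le B\langle h,h\rangle$. It is a c-g-Bessel sequence if (a) and the right-hand inequality in (b) hold for some $B$. A c-g-Bessel sequence $\{\Phi_\xi\}$ is a c-$K$-g-dual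 (dual c-$K$-g-Bessel sequence) of a c-$K$-g-frame $\{\Upsilon_\xi\}$ if $\langle Kg,h\rangle=\int_\Omega\langle\Upsilon_\xi^*\Phi_\xi g,h\rangle\,\mathrm d\nu(\xi)$ for all $g,h\in\mathcal H$. $\bigoplus_{\xi\in\Omega}\mathcal H_\xi$ denotes the Hilbert $\mathcal A$-module of families $\{\alpha_\xi\}$, $\alpha_\xi\in\mathcal H_\xi$, with $\|\int_\Omega\langle\alpha_\xi,\alpha_\xi\rangle\,\mathrm d\nu(\xi)\|<\infty$, with inner product $\langle f,g\rangle=\int_\Omega\langle f_\xi,g_\xi\rangle\,\mathrm d\nu(\xi)$. The synthesis operator of a c-g-Bessel sequence $\{\Upsilon_\xi\}$ is $\mathcal T_\Upsilon:\bigoplus_{\xi\in\Omega}\mathcal H_\xi\to\mathcal H$, weakly defined by $\langle\mathcal T_\Upsilon F,g\rangle=\int_\Omega\langle\Upsilon_\xi^*F(\xi),g\rangle\,\mathrm d\nu(\xi)$; its adjoint is given by $(\mathcal T_\Upsilon^*g)(\xi)=\Upsilon_\xi g$. $\mathcal T_\Phi$ is defined in the same way from $\{\Phi_\xi\}$. *)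

theory Defs
  imports "HOL-Analysis.Analysis"
begin

section \<open>Unital C*-algebras\<close>

class cstar_algebra = real_normed_algebra_1 + banach +
  fixes scaleC :: "complex \<Rightarrow> 'a \<Rightarrow> 'a" (infixr \<open>*\<^sub>C\<close> 75)
    and star :: "'a \<Rightarrow> 'a"
  assumes scaleC_add_right: "c *\<^sub>C (a + b) = c *\<^sub>C a + c *\<^sub>C b"
    and scaleC_add_left: "(c + d) *\<^sub>C a = c *\<^sub>C a + d *\<^sub>C a"
    and scaleC_scaleC: "c *\<^sub>C d *\<^sub>C a = (c * d) *\<^sub>C a"
    and scaleR_scaleC: "r *\<^sub>R a = complex_of_real r *\<^sub>C a"
    and mult_scaleC_left: "(c *\<^sub>C a) * b = c *\<^sub>C (a * b)"
    and mult_scaleC_right: "a * (c *\<^sub>C b) = c *\<^sub>C (a * b)"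
    and norm_scaleC: "norm (c *\<^sub>C a) = cmod c * norm a"
    and star_star: "star (star a) = a"
    and star_add: "star (a + b) = star a + star b"
    and star_scaleC: "star (c *\<^sub>C a) = cnj c *\<^sub>C star a"
    and star_mult: "star (a * b) = star b * star a"
    and norm_star_mult: "norm (star a * a) = (norm a)\<^sup>2"

definition alg_spectrum :: "'a::cstar_algebra \<Rightarrow> complex set" where
  "alg_spectrum a = {z. \<not> (\<exists>b. (a - z *\<^sub>C 1) * b = 1 \<and> b * (a - z *\<^sub>C 1) = 1)}"

definition cstar_nonneg :: "'a::cstar_algebra \<Rightarrow> bool" where
  "cstar_nonneg a \<longleftrightarrow> star a = a \<and> (\<forall>z\<in>alg_spectrum a. z \<in> \<real> \<and> 0 \<le> Re z)"

definition cstar_le :: "'a::cstar_algebra \<Rightarrow> 'a \<Rightarrow> bool" (infix \<open>\<preceq>\<close> 50) where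
  "a \<preceq> b \<longleftrightarrow> cstar_nonneg (b - a)"


section \<open>Bochner integral\<close>

text \<open>The integral of the library is restricted to second countable range types, i.e. to
  separable Banach spaces. Its definition is repeated here without that restriction. Measurable
  then has to mean strongly measurable: Borel measurable functions into a
  non-separable space are not closed under addition.\<close>

definition strongly_measurable :: "'w measure \<Rightarrow> ('w \<Rightarrow> 'b::real_normed_vector) \<Rightarrow> bool" where
  "strongly_measurable M f \<longleftrightarrow>
     f \<in> borel_measurable M \<and> (\<exists>D. countable D \<and> f ` space M \<subseteq> closure D)"

definition has_vec_integral :: "'w measure \<Rightarrow> ('w \<Rightarrow> 'b::real_normed_vector) \<Rightarrow> 'b \<Rightarrow> bool" where
  "has_vec_integral M f x \<longleftrightarrow> strongly_measurable M f \<and>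
     (\<exists>s. (\<forall>i. Bochner_Integration.simple_bochner_integrable M (s i)) \<and>
          (\<lambda>i. \<integral>\<^sup>+ \<xi>. norm (f \<xi> - s i \<xi>) \<partial>M) \<longlonglongrightarrow> 0 \<and>
          (\<lambda>i. Bochner_Integration.simple_bochner_integral M (s i)) \<longlonglongrightarrow> x)"

definition vec_integrable :: "'w measure \<Rightarrow> ('w \<Rightarrow> 'b::real_normed_vector) \<Rightarrow> bool" where
  "vec_integrable M f \<longleftrightarrow> (\<exists>x. has_vec_integral M f x)"

definition vec_integral :: "'w measure \<Rightarrow> ('w \<Rightarrow> 'b::real_normed_vector) \<Rightarrow> 'b" where
  "vec_integral M f = (THE x. has_vec_integral M f x)"


section \<open>Hilbert C*-modules and adjointable operators\<close>

record ('a, 'h) cstar_mod =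
  carrier :: "'h set"
  act :: "'a \<Rightarrow> 'h \<Rightarrow> 'h" (infixr \<open>\<cdot>\<index>\<close> 75)
  ip :: "'h \<Rightarrow> 'h \<Rightarrow> 'a" (\<open>\<langle>_, _\<rangle>\<index>\<close>)

text \<open>Addition, real scalars and norm of a Hilbert module are those of the
  ambient type. Since the algebra is unital, the complex scalar multiplication of the module
  is the action of the elements \<open>c *\<^sub>C 1\<close>.\<close>

locale hilbert_module =
  fixes E :: "('a::cstar_algebra, 'h::real_normed_vector) cstar_mod" (structure)
  assumes zero_closed: "0 \<in> carrier E"
    and add_closed: "\<lbrakk>x \<in> carrier E; y \<in> carrier E\<rbrakk> \<Longrightarrow> x + y \<in> carrier E"
    and act_closed: "x \<in> carrier E \<Longrightarrow> a \<cdot> x \<in> carrier E"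
    and act_add_right: "\<lbrakk>x \<in> carrier E; y \<in> carrier E\<rbrakk> \<Longrightarrow> a \<cdot> (x + y) = a \<cdot> x + a \<cdot> y"
    and act_add_left: "x \<in> carrier E \<Longrightarrow> (a + b) \<cdot> x = a \<cdot> x + b \<cdot> x"
    and act_act: "x \<in> carrier E \<Longrightarrow> a \<cdot> b \<cdot> x = (a * b) \<cdot> x"
    and scaleR_act: "x \<in> carrier E \<Longrightarrow> r *\<^sub>R x = of_real r \<cdot> x"
    and ip_add_left: "\<lbrakk>x \<in> carrier E; y \<in> carrier E; z \<in> carrier E\<rbrakk>
          \<Longrightarrow> \<langle>x + y, z\<rangle> = \<langle>x, z\<rangle> + \<langle>y, z\<rangle>"
    and ip_act_left: "\<lbrakk>x \<in> carrier E; y \<in> carrier E\<rbrakk> \<Longrightarrow> \<langle>a \<cdot> x, y\<rangle> = a * \<langle>x, y\<rangle>"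
    and ip_star: "\<lbrakk>x \<in> carrier E; y \<in> carrier E\<rbrakk> \<Longrightarrow> star \<langle>x, y\<rangle> = \<langle>y, x\<rangle>"
    and ip_nonneg: "x \<in> carrier E \<Longrightarrow> 0 \<preceq> \<langle>x, x\<rangle>"
    and ip_definite: "\<lbrakk>x \<in> carrier E; \<langle>x, x\<rangle> = 0\<rbrakk> \<Longrightarrow> x = 0"
    and norm_ip: "x \<in> carrier E \<Longrightarrow> norm x = sqrt (norm \<langle>x, x\<rangle>)"
    and complete_carrier: "complete (carrier E)"

definition closed_submodule ::
  "'h::real_normed_vector set \<Rightarrow> ('a::cstar_algebra, 'h) cstar_mod \<Rightarrow> bool" where
  "closed_submodule X E \<longleftrightarrow> X \<subseteq> carrier E \<and> 0 \<in> X \<and> (\<forall>x\<in>X. \<forall>y\<in>X. x + y \<in> X) \<and>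
     (\<forall>a. \<forall>x\<in>X. a \<cdot>\<^bsub>E\<^esub> x \<in> X) \<and> closed X"

abbreviation submod :: "('a, 'h) cstar_mod \<Rightarrow> 'h set \<Rightarrow> ('a, 'h) cstar_mod" where
  "submod E X \<equiv> E\<lparr>carrier := X\<rparr>"

definition adjoint_pair ::
  "('a, 'h) cstar_mod \<Rightarrow> ('a, 'k) cstar_mod \<Rightarrow> ('h \<Rightarrow> 'k) \<Rightarrow> ('k \<Rightarrow> 'h) \<Rightarrow> bool" where
  "adjoint_pair E F T T' \<longleftrightarrow>
     T \<in> carrier E \<rightarrow> carrier F \<and> T' \<in> carrier F \<rightarrow> carrier E \<and>
     (\<forall>x\<in>carrier E. \<forall>y\<in>carrier F. \<langle>T x, y\<rangle>\<^bsub>F\<^esub> = \<langle>x, T' y\<rangle>\<^bsub>E\<^esub>)"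

definition endo_star ::
  "('a, 'h::plus) cstar_mod \<Rightarrow> ('a, 'k::plus) cstar_mod \<Rightarrow> ('h \<Rightarrow> 'k) set" where
  "endo_star E F = {T. T \<in> carrier E \<rightarrow> carrier F \<and>
     (\<forall>x\<in>carrier E. \<forall>y\<in>carrier E. T (x + y) = T x + T y) \<and>
     (\<forall>a. \<forall>x\<in>carrier E. T (a \<cdot>\<^bsub>E\<^esub> x) = a \<cdot>\<^bsub>F\<^esub> T x) \<and>
     (\<exists>T'. adjoint_pair E F T T')}"

text \<open>The inner product of a Hilbert module is definite, so the description below is unique.\<close>

definition adj ::
  "('a, 'h) cstar_mod \<Rightarrow> ('a, 'k) cstar_mod \<Rightarrow> ('h \<Rightarrow> 'k) \<Rightarrow> 'k \<Rightarrow> 'h" where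
  "adj E F T y =
     (THE z. z \<in> carrier E \<and> (\<forall>x\<in>carrier E. \<langle>T x, y\<rangle>\<^bsub>F\<^esub> = \<langle>x, z\<rangle>\<^bsub>E\<^esub>))"

definition positive_op :: "('a::cstar_algebra, 'h::plus) cstar_mod \<Rightarrow> ('h \<Rightarrow> 'h) \<Rightarrow> bool" where
  "positive_op E T \<longleftrightarrow> T \<in> endo_star E E \<and> (\<forall>x\<in>carrier E. 0 \<preceq> \<langle>T x, x\<rangle>\<^bsub>E\<^esub>)"


section \<open>Continuous K-g-frames\<close>

text \<open>The family of submodules is given by its carriers \<open>S \<xi> \<subseteq> carrier K\<close>. Values of all families
  outside \<open>space \<nu>\<close> are irrelevant.\<close>

definition op_family ::
  "'w measure \<Rightarrow> ('a::cstar_algebra, 'h::real_normed_vector) cstar_mod \<Rightarrow>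
   ('a, 'k::real_normed_vector) cstar_mod \<Rightarrow> ('w \<Rightarrow> 'k set) \<Rightarrow> ('w \<Rightarrow> 'h \<Rightarrow> 'k) \<Rightarrow> bool" where
  "op_family \<nu> H K S \<Upsilon> \<longleftrightarrow>
     (\<forall>\<xi>\<in>space \<nu>. \<Upsilon> \<xi> \<in> endo_star H (submod K (S \<xi>))) \<and>
     (\<forall>h\<in>carrier H. strongly_measurable \<nu> (\<lambda>\<xi>. \<Upsilon> \<xi> h))"

definition cg_bessel ::
  "'w measure \<Rightarrow> ('a::cstar_algebra, 'h::real_normed_vector) cstar_mod \<Rightarrow>
   ('a, 'k::real_normed_vector) cstar_mod \<Rightarrow> ('w \<Rightarrow> 'k set) \<Rightarrow> ('w \<Rightarrow> 'h \<Rightarrow> 'k) \<Rightarrow> bool" where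
  "cg_bessel \<nu> H K S \<Upsilon> \<longleftrightarrow> op_family \<nu> H K S \<Upsilon> \<and>
     (\<exists>B>0. \<forall>h\<in>carrier H.
        vec_integrable \<nu> (\<lambda>\<xi>. \<langle>\<Upsilon> \<xi> h, \<Upsilon> \<xi> h\<rangle>\<^bsub>K\<^esub>) \<and>
        vec_integral \<nu> (\<lambda>\<xi>. \<langle>\<Upsilon> \<xi> h, \<Upsilon> \<xi> h\<rangle>\<^bsub>K\<^esub>) \<preceq> B *\<^sub>R \<langle>h, h\<rangle>\<^bsub>H\<^esub>)"

definition cKg_frame ::
  "'w measure \<Rightarrow> ('a::cstar_algebra, 'h::real_normed_vector) cstar_mod \<Rightarrow>
   ('a, 'k::real_normed_vector) cstar_mod \<Rightarrow> ('w \<Rightarrow> 'k set) \<Rightarrow>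
   ('h \<Rightarrow> 'h) \<Rightarrow> ('w \<Rightarrow> 'h \<Rightarrow> 'k) \<Rightarrow> bool" where
  "cKg_frame \<nu> H K S L \<Upsilon> \<longleftrightarrow> op_family \<nu> H K S \<Upsilon> \<and>
     (\<exists>A B. 0 < A \<and> A \<le> B \<and> (\<forall>h\<in>carrier H.
        vec_integrable \<nu> (\<lambda>\<xi>. \<langle>\<Upsilon> \<xi> h, \<Upsilon> \<xi> h\<rangle>\<^bsub>K\<^esub>) \<and>
        A *\<^sub>R \<langle>adj H H L h, adj H H L h\<rangle>\<^bsub>H\<^esub>
          \<preceq> vec_integral \<nu> (\<lambda>\<xi>. \<langle>\<Upsilon> \<xi> h, \<Upsilon> \<xi> h\<rangle>\<^bsub>K\<^esub>) \<and>
        vec_integral \<nu> (\<lambda>\<xi>. \<langle>\<Upsilon> \<xi> h, \<Upsilon> \<xi> h\<rangle>\<^bsub>K\<^esub>) \<preceq> B *\<^sub>R \<langle>h, h\<rangle>\<^bsub>H\<^esub>))"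

definition cKg_dual ::
  "'w measure \<Rightarrow> ('a::cstar_algebra, 'h::real_normed_vector) cstar_mod \<Rightarrow>
   ('a, 'k::real_normed_vector) cstar_mod \<Rightarrow> ('w \<Rightarrow> 'k set) \<Rightarrow>
   ('h \<Rightarrow> 'h) \<Rightarrow> ('w \<Rightarrow> 'h \<Rightarrow> 'k) \<Rightarrow> ('w \<Rightarrow> 'h \<Rightarrow> 'k) \<Rightarrow> bool" where
  "cKg_dual \<nu> H K S L \<Upsilon> \<Phi> \<longleftrightarrow> cg_bessel \<nu> H K S \<Phi> \<and>
     (\<forall>g\<in>carrier H. \<forall>h\<in>carrier H.
        has_vec_integral \<nu> (\<lambda>\<xi>. \<langle>adj H (submod K (S \<xi>)) (\<Upsilon> \<xi>) (\<Phi> \<xi> g), h\<rangle>\<^bsub>H\<^esub>) \<langle>L g, h\<rangle>\<^bsub>H\<^esub>)"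

text \<open>Families are not identified when they agree almost everywhere, so the inner
  product of the direct sum is only semidefinite, and adjoints of operators out of it are determined
  up to equality almost everywhere. For this reason they are expressed by \<^const>\<open>adjoint_pair\<close>
  rather than by \<^const>\<open>adj\<close>.\<close>

definition direct_sum ::
  "'w measure \<Rightarrow> ('a::cstar_algebra, 'k::real_normed_vector) cstar_mod \<Rightarrow> ('w \<Rightarrow> 'k set) \<Rightarrow>
   ('a, 'w \<Rightarrow> 'k) cstar_mod" where
  "direct_sum \<nu> K S =
     \<lparr>carrier = {F. (\<forall>\<xi>\<in>space \<nu>. F \<xi> \<in> S \<xi>) \<and> strongly_measurable \<nu> F \<and>
                    vec_integrable \<nu> (\<lambda>\<xi>. \<langle>F \<xi>, F \<xi>\<rangle>\<^bsub>K\<^esub>)},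
      act = (\<lambda>a F \<xi>. a \<cdot>\<^bsub>K\<^esub> F \<xi>),
      ip = (\<lambda>F G. vec_integral \<nu> (\<lambda>\<xi>. \<langle>F \<xi>, G \<xi>\<rangle>\<^bsub>K\<^esub>))\<rparr>"

text \<open>The weak definition determines the synthesis operator uniquely, but it does not by itself
  provide a value in \<open>H\<close>, as Hilbert modules need not be self-dual. Hence a predicate.\<close>

definition synthesis_op ::
  "'w measure \<Rightarrow> ('a::cstar_algebra, 'h::real_normed_vector) cstar_mod \<Rightarrow>
   ('a, 'k::real_normed_vector) cstar_mod \<Rightarrow> ('w \<Rightarrow> 'k set) \<Rightarrow> ('w \<Rightarrow> 'h \<Rightarrow> 'k) \<Rightarrow>
   (('w \<Rightarrow> 'k) \<Rightarrow> 'h) \<Rightarrow> bool" where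
  "synthesis_op \<nu> H K S \<Upsilon> T \<longleftrightarrow>
     T \<in> carrier (direct_sum \<nu> K S) \<rightarrow> carrier H \<and>
     (\<forall>F\<in>carrier (direct_sum \<nu> K S). \<forall>g\<in>carrier H.
        has_vec_integral \<nu> (\<lambda>\<xi>. \<langle>adj H (submod K (S \<xi>)) (\<Upsilon> \<xi>) (F \<xi>), g\<rangle>\<^bsub>H\<^esub>) \<langle>T F, g\<rangle>\<^bsub>H\<^esub>)"

end

theory Submission
  imports Defs
begin

text \<open>Expanding the inner product, the integral of \<open>\<langle>(\<Upsilon> + \<Phi>) h, (\<Upsilon> + \<Phi>) h\<rangle>\<close> is the sum of those for
  \<open>\<Upsilon>\<close> and \<open>\<Phi>\<close> plus twice the cross term, which is \<open>\<langle>K1 h, h\<rangle> \<ge> 0\<close> in (i) and \<open>0\<close> in (ii). Hence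
  the lower bound of \<open>\<Upsilon>\<close>, resp. \<open>\<Phi>\<close>, survives, and the upper bound follows from the parallelogram law.
  In (ii), \<open>T\<^sub>\<Phi>_adj h\<close> agrees with \<open>\<Phi> h\<close> only up to a null vector of the direct sum, on which
  the cross term does not depend.

  The order of the algebra enters through the fact that the nonnegative elements form a closed convex cone
  containing no line. This rests on the equality of norm and spectral radius for selfadjoint elements.\<close>


section \<open>Complex scalars and involution\<close>

text \<open>Positivity is defined through the spectrum, which gives no direct access to sums or
  limits. The spectral radius equality turns it into the norm condition
  \<open>norm (t *\<^sub>R 1 - a) \<le> t\<close>, from which additivity and closedness are read
  off. A closed convex cone is also what survives integration: a Bochner integral of values in it
  stays in it, and the same fact for the cone \<open>{0}\<close> is the uniqueness that gives
  \<open>vec_integral\<close> its meaning. That the cone contains no line makes the cross term of a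
  null vector vanish, since it is the slope of an affine expression that is nonnegative for every
  real parameter. Integrability of the cross term in the theorem is never derived by an estimate: it
  is supplied by the duality in (i) and by the weak formula for the synthesis operator in
  (ii).\<close>

lemma scaleC_one [simp]: "1 *\<^sub>C a = (a :: 'a::cstar_algebra)"
  using scaleR_scaleC[of 1 a] by simp

lemma scaleC_zero_left [simp]: "0 *\<^sub>C a = (0 :: 'a::cstar_algebra)"
  using scaleR_scaleC[of 0 a] by simp

lemma scaleC_zero_right [simp]: "c *\<^sub>C 0 = (0 :: 'a::cstar_algebra)"
  using norm_scaleC[of c "0::'a"] by simp

lemma scaleC_minus_left: "(- c) *\<^sub>C a = - (c *\<^sub>C a :: 'a::cstar_algebra)"
  using scaleC_add_left[of "- c" c a] by (simp add: eq_neg_iff_add_eq_0)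

lemma scaleC_minus_right: "c *\<^sub>C (- a) = - (c *\<^sub>C a :: 'a::cstar_algebra)"
  using scaleC_add_right[of c "- a" a] by (simp add: eq_neg_iff_add_eq_0)

lemma scaleC_diff_left: "(c - d) *\<^sub>C a = c *\<^sub>C a - d *\<^sub>C (a :: 'a::cstar_algebra)"
  by (metis diff_conv_add_uminus scaleC_add_left scaleC_minus_left)

lemma scaleC_diff_right: "c *\<^sub>C (a - b) = c *\<^sub>C a - c *\<^sub>C (b :: 'a::cstar_algebra)"
  by (metis diff_conv_add_uminus scaleC_add_right scaleC_minus_right)

lemma scaleC_of_real: "complex_of_real r *\<^sub>C a = r *\<^sub>R (a :: 'a::cstar_algebra)"
  by (simp add: scaleR_scaleC)

lemma star_one [simp]: "star 1 = (1 :: 'a::cstar_algebra)"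
  by (metis mult.right_neutral star_mult star_star)

lemma star_zero [simp]: "star 0 = (0 :: 'a::cstar_algebra)"
  using star_add[of "0::'a" 0] by simp

lemma star_minus: "star (- a) = - star (a :: 'a::cstar_algebra)"
  using star_add[of "- a" a] by (simp add: eq_neg_iff_add_eq_0)

lemma star_diff: "star (a - b) = star a - star (b :: 'a::cstar_algebra)"
  by (metis diff_conv_add_uminus star_add star_minus)

lemma star_scaleR: "star (r *\<^sub>R a) = r *\<^sub>R star (a :: 'a::cstar_algebra)"
  by (simp add: scaleR_scaleC star_scaleC)

lemma star_power: "star (a ^ n) = star (a :: 'a::cstar_algebra) ^ n"
  by (induction n) (simp_all add: star_mult power_commutes)

lemma norm_star: "norm (star a) = norm (a :: 'a::cstar_algebra)"
proof -
  have le: "norm x \<le> norm (star x)" for x :: 'a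
  proof (cases "x = 0")
    case False
    have "norm x * norm x \<le> norm (star x) * norm x"
      using norm_star_mult[of x] norm_mult_ineq[of "star x" x] by (simp add: power2_eq_square)
    with False show ?thesis by simp
  qed simp
  from le[of a] le[of "star a"] show ?thesis by (simp add: star_star)
qed

lemma bounded_linear_star: "bounded_linear (star :: 'a::cstar_algebra \<Rightarrow> 'a)"
  by (rule bounded_linear_intro[where K = 1]) (simp_all add: star_add star_scaleR norm_star)

lemma bounded_linear_scaleC: "bounded_linear ((*\<^sub>C) c :: 'a::cstar_algebra \<Rightarrow> 'a)"
  by (rule bounded_linear_intro[where K = "cmod c"])
    (simp_all add: scaleC_add_right norm_scaleC scaleR_scaleC scaleC_scaleC mult.commute)

text \<open>For selfadjoint elements the C*-identity reads: squaring squares the norm. Iterating it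
  reaches only exponents that are powers of two, so the spectral radius argument below runs along
  \<open>2 ^ m\<close>.\<close>

lemma norm_selfadjoint_power:
  assumes "star b = (b :: 'a::cstar_algebra)"
  shows "norm (b ^ 2 ^ m) = norm b ^ 2 ^ m"
proof (induction m)
  case (Suc m)
  have "b ^ 2 ^ Suc m = star (b ^ 2 ^ m) * b ^ 2 ^ m"
    by (simp add: star_power assms mult_2 power_add)
  then have "norm (b ^ 2 ^ Suc m) = norm (b ^ 2 ^ m) ^ 2"
    by (simp only: norm_star_mult)
  with Suc show ?case by (simp add: power_mult[symmetric] mult.commute)
qed simp


section \<open>The spectrum of a selfadjoint element\<close>

text \<open>A relation that names the inverse, because resolvents are handled below as explicit
  functions of a complex parameter that are averaged and compared in norm.\<close>

definition inverses :: "'a::monoid_mult \<Rightarrow> 'a \<Rightarrow> bool" where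
  "inverses x y \<longleftrightarrow> x * y = 1 \<and> y * x = 1"

lemma alg_spectrum_iff: "z \<in> alg_spectrum a \<longleftrightarrow> (\<nexists>y. inverses (a - z *\<^sub>C 1) y)"
  by (simp add: alg_spectrum_def inverses_def)

lemma inverses_scaleC:
  assumes "inverses x (y :: 'a::cstar_algebra)" "c \<noteq> 0"
  shows "inverses (c *\<^sub>C x) (inverse c *\<^sub>C y)"
  using assms by (simp add: inverses_def mult_scaleC_left mult_scaleC_right scaleC_scaleC)

text \<open>Neumann series.\<close>

lemma inverses_one_minus:
  fixes x :: "'a::{real_normed_algebra_1,banach}"
  assumes "norm x < 1"
  shows "\<exists>y. inverses (1 - x) y"
proof -
  have s: "summable (\<lambda>n. x ^ n)"
    by (rule complete_algebra_summable_geometric[OF assms])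
  have eq: "(\<Sum>n. x ^ n) = 1 + (\<Sum>n. x ^ Suc n)"
    using suminf_split_head[OF s] by simp
  have "(\<Sum>n. x ^ Suc n) = x * (\<Sum>n. x ^ n)" "(\<Sum>n. x ^ Suc n) = (\<Sum>n. x ^ n) * x"
    using suminf_mult[OF s, of x] suminf_mult2[OF s, of x] by (simp_all add: power_commutes)
  with eq have "inverses (1 - x) (\<Sum>n. x ^ n)"
    unfolding inverses_def by (simp add: algebra_simps)
  then show ?thesis ..
qed

lemma spectrum_norm_le:
  assumes "z \<in> alg_spectrum (a :: 'a::cstar_algebra)"
  shows "cmod z \<le> norm a"
proof (rule ccontr)
  assume "\<not> cmod z \<le> norm a"
  then have z: "norm a < cmod z" by simp
  then have "z \<noteq> 0" by auto
  have "norm (inverse z *\<^sub>C a) < 1"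
    using z \<open>z \<noteq> 0\<close> by (simp add: norm_scaleC norm_inverse norm_divide field_simps)
  then obtain y where "inverses (1 - inverse z *\<^sub>C a) y"
    using inverses_one_minus by blast
  then have "inverses ((- z) *\<^sub>C (1 - inverse z *\<^sub>C a)) (inverse (- z) *\<^sub>C y)"
    using \<open>z \<noteq> 0\<close> by (intro inverses_scaleC) auto
  moreover have "(- z) *\<^sub>C (1 - inverse z *\<^sub>C a) = a - z *\<^sub>C 1"
    using \<open>z \<noteq> 0\<close> by (simp add: scaleC_diff_right scaleC_scaleC scaleC_minus_left)
  ultimately show False using assms by (auto simp: alg_spectrum_iff)
qed

lemma spectrum_add_scalar:
  "z \<in> alg_spectrum a \<longleftrightarrow> z + w \<in> alg_spectrum (a + w *\<^sub>C (1 :: 'a::cstar_algebra))"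
proof -
  have "a + w *\<^sub>C 1 - (z + w) *\<^sub>C 1 = a - z *\<^sub>C 1" by (simp add: scaleC_add_left)
  then show ?thesis by (simp only: alg_spectrum_iff)
qed

lemma spectrum_minus:
  assumes "z \<in> alg_spectrum (- a :: 'a::cstar_algebra)"
  shows "- z \<in> alg_spectrum a"
proof (rule ccontr)
  assume "- z \<notin> alg_spectrum a"
  then obtain y where "inverses (a - (- z) *\<^sub>C 1) y" by (auto simp: alg_spectrum_iff)
  then have "inverses (- a - z *\<^sub>C 1) (- y)"
    by (simp add: inverses_def scaleC_minus_left algebra_simps)
  with assms show False by (auto simp: alg_spectrum_iff)
qed

text \<open>Arens' trick: compare \<open>\<bar>z + i t\<bar>\<close> with the norm of \<open>a + i t\<close> for large real \<open>t\<close>.\<close>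

lemma spectrum_selfadjoint_real:
  assumes sa: "star a = (a :: 'a::cstar_algebra)" and z: "z \<in> alg_spectrum a"
  shows "z \<in> \<real>"
proof (rule ccontr)
  assume "z \<notin> \<real>"
  then have y: "Im z \<noteq> 0" by (simp add: complex_is_Real_iff)
  \<comment> \<open>Expanding the square of \<open>cmod (z + \<i> * t)\<close> leaves
    \<open>2 * Im z * t\<close> once \<open>t\<^sup>2\<close> has cancelled. This choice makes that
    term exceed \<open>(norm a)\<^sup>2\<close> by 1, while everything else on its side is a
    square.\<close>
  define t where "t = ((norm a)\<^sup>2 + 1) / (2 * Im z)"
  define u where "u = a + (\<i> * t) *\<^sub>C 1"
  have "star u * u = a * a + (t\<^sup>2) *\<^sub>R 1"
    by (simp add: u_def star_add star_scaleC sa algebra_simps mult_scaleC_left mult_scaleC_right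
        scaleC_scaleC scaleR_scaleC power2_eq_square scaleC_minus_left scaleC_diff_right)
  then have "(norm u)\<^sup>2 \<le> norm (a * a) + norm ((t\<^sup>2) *\<^sub>R (1::'a))"
    by (metis norm_star_mult norm_triangle_ineq)
  also have "\<dots> \<le> (norm a)\<^sup>2 + t\<^sup>2"
    using norm_mult_ineq[of a a] by (simp add: power2_eq_square)
  finally have u: "(norm u)\<^sup>2 \<le> (norm a)\<^sup>2 + t\<^sup>2" .
  have "z + \<i> * t \<in> alg_spectrum u"
    using z spectrum_add_scalar[of z a "\<i> * t"] by (simp add: u_def)
  then have "cmod (z + \<i> * t) \<le> norm u" by (rule spectrum_norm_le)
  then have "(cmod (z + \<i> * t))\<^sup>2 \<le> (norm u)\<^sup>2" by (rule power_mono) simp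
  moreover have "(cmod (z + \<i> * t))\<^sup>2 = (Re z)\<^sup>2 + (Im z + t)\<^sup>2"
    by (simp add: cmod_power2)
  ultimately have "(Re z)\<^sup>2 + (Im z)\<^sup>2 + 2 * Im z * t \<le> (norm a)\<^sup>2"
    using u by (simp add: power2_sum)
  moreover have "2 * Im z * t = (norm a)\<^sup>2 + 1" using y by (simp add: t_def)
  ultimately show False by (smt (verit) zero_le_power2)
qed

text \<open>The resolvent identity: insert \<open>(1 - y) * q = 1\<close> to the right of
  \<open>p\<close> and \<open>p * (1 - x) = 1\<close> to the left of \<open>q\<close>.\<close>

lemma inverses_diff_eq:
  assumes "inverses (1 - x) (p :: 'a::ring_1)" "inverses (1 - y) q"
  shows "p - q = p * (x - y) * q"
proof -
  have "p * (x - y) * q = p * ((1 - y) * q) - (p * (1 - x)) * q"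
    by (simp add: algebra_simps)
  then show ?thesis using assms by (simp add: inverses_def)
qed

text \<open>The resolvent identity bounds \<open>norm (R w - R v)\<close> by a multiple of
  \<open>norm (R w)\<close>, which is itself unknown. So it is used twice: first to get
  \<open>norm (R w) \<le> 2 * norm (R v)\<close> near \<open>v\<close>, then with this bound
  inserted.\<close>

lemma resolvent_continuous:
  fixes b :: "'a::cstar_algebra"
  assumes R: "\<And>w. w \<in> X \<Longrightarrow> inverses (1 - w *\<^sub>C b) (R w)"
  shows "continuous_on X R"
  unfolding continuous_on_iff
proof (intro ballI allI impI)
  fix v e :: "complex" and \<epsilon> :: real
  assume v: "v \<in> X" and e: "\<epsilon> > 0"
  define C where "C = norm b * norm (R v)"
  define n where "n = norm (R v)"
  have nn: "C \<ge> 0" "n \<ge> 0" by (auto simp: C_def n_def)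
  \<comment> \<open>The first entry gives \<open>d * C \<le> 1/2\<close>, hence the factor 2 bound
    on \<open>norm (R w)\<close>; the second brings the resulting estimate below \<epsilon>. The
    added ones avoid division by zero and make the final inequality strict.\<close>
  define d where "d = min (1 / (2 * (C + 1))) (\<epsilon> / (2 * (C + 1) * (n + 1)))"
  have d: "d > 0" using nn e by (simp add: d_def divide_pos_pos add_nonneg_pos)
  have d1: "d * C \<le> 1/2"
  proof -
    have "d * C \<le> 1 / (2 * (C + 1)) * C" using nn by (intro mult_right_mono) (auto simp: d_def)
    also have "\<dots> \<le> 1/2" using nn by (simp add: field_simps)
    finally show ?thesis .
  qed
  have d2: "d * (C + 1) * (2 * (n + 1)) \<le> \<epsilon>"
  proof -
    have "d * (C + 1) * (2 * (n + 1)) \<le> \<epsilon> / (2 * (C + 1) * (n + 1)) * (C + 1) * (2 * (n + 1))"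
      using nn by (intro mult_right_mono) (auto simp: d_def)
    also have "\<dots> = \<epsilon>" using nn by (simp add: divide_simps add_nonneg_eq_0_iff) (simp add: algebra_simps)
    finally show ?thesis .
  qed
  show "\<exists>d>0. \<forall>w\<in>X. dist w v < d \<longrightarrow> dist (R w) (R v) < \<epsilon>"
  proof (intro exI[of _ d] conjI ballI impI d)
    fix w assume w: "w \<in> X" "dist w v < d"
    have "R w - R v = R w * ((w - v) *\<^sub>C b) * R v"
      using inverses_diff_eq[OF R[OF w(1)] R[OF v]] by (simp add: scaleC_diff_left)
    then have "norm (R w - R v) \<le> norm (R w * ((w - v) *\<^sub>C b)) * norm (R v)"
      by (simp only: norm_mult_ineq)
    also have "\<dots> \<le> norm (R w) * norm ((w - v) *\<^sub>C b) * norm (R v)"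
      by (intro mult_right_mono norm_mult_ineq norm_ge_zero)
    also have "\<dots> = norm (R w) * (cmod (w - v) * C)" by (simp add: norm_scaleC C_def)
    also have "\<dots> \<le> norm (R w) * (d * C)"
      using w nn by (intro mult_left_mono mult_right_mono) (auto simp: dist_norm)
    finally have *: "norm (R w - R v) \<le> norm (R w) * (d * C)" .
    also have "\<dots> \<le> norm (R w) * (1/2)" by (intro mult_left_mono d1) auto
    finally have "norm (R w - R v) \<le> norm (R w) / 2" by simp
    moreover have "norm (R w) \<le> norm (R v) + norm (R w - R v)"
      by (metis norm_triangle_sub)
    ultimately have "norm (R w) \<le> 2 * n" by (simp add: n_def)
    then have "norm (R w) * (d * C) \<le> 2 * n * (d * C)"
      using nn d by (intro mult_right_mono) auto
    also have "\<dots> \<le> 2 * n * (d * (C + 1))"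
      using nn d by (intro mult_left_mono) auto
    also have "\<dots> < 2 * (n + 1) * (d * (C + 1))"
      using nn d by (intro mult_strict_right_mono) auto
    also have "\<dots> \<le> \<epsilon>" using d2 by (simp add: mult.commute mult.left_commute)
    finally show "dist (R w) (R v) < \<epsilon>" using * by (simp add: dist_norm)
  qed
qed

text \<open>Partial fractions: 1/(1 - u^2) is the mean of 1/(1 - u) and 1/(1 + u).\<close>

lemma inverses_halving:
  fixes u :: "'a::real_algebra_1"
  assumes "inverses (1 - u) p" "inverses (1 + u) q"
  shows "inverses (1 - u * u) ((1/2) *\<^sub>R (p + q))"
proof -
  have "(1 - u * u) * p = (1 + u) * ((1 - u) * p)" "(1 - u * u) * q = (1 - u) * ((1 + u) * q)"
    "p * (1 - u * u) = (p * (1 - u)) * (1 + u)" "q * (1 - u * u) = (q * (1 + u)) * (1 - u)"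
    by (simp_all add: algebra_simps)
  then have "(1 - u * u) * p = 1 + u" "(1 - u * u) * q = 1 - u"
    "p * (1 - u * u) = 1 + u" "q * (1 - u * u) = 1 - u"
    using assms unfolding inverses_def by (metis mult_1_left mult_1_right)+
  then have "(1 - u * u) * (p + q) = 2" "(p + q) * (1 - u * u) = 2"
    by (simp_all add: distrib_left distrib_right del: distrib_left_numeral)
  moreover have "(1/2) *\<^sub>R (2::'a) = 1"
    by (metis (no_types) of_real_def of_real_numeral scaleR_scaleR of_real_1 divide_self_if
        zero_neq_numeral times_divide_eq_left mult_1)
  ultimately show ?thesis by (simp add: inverses_def)
qed

text \<open>An elementary substitute for the spectral radius formula. If \<open>1 - w b\<close> were invertible for
  all \<open>\<bar>w\<bar> \<le> 1 / \<parallel>b\<parallel>\<close>, then averaging over \<open>w\<close> and \<open>\<zeta> w\<close> with \<open>\<zeta> ^ 2 ^ m = -1\<close> shows, by induction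
  on \<open>m\<close>, that the inverses of \<open>1 - (w b) ^ 2 ^ m\<close> are equicontinuous in \<open>w\<close>. They tend to \<open>1\<close> for
  \<open>\<bar>w\<bar> < 1 / \<parallel>b\<parallel>\<close>, hence are close to \<open>1\<close> on the boundary, where \<open>\<parallel>(w b) ^ 2 ^ m\<parallel> = 1\<close>.\<close>

lemma selfadjoint_norm_le_spectrum:
  fixes b :: "'a::cstar_algebra"
  assumes sa: "star b = b" and nz: "b \<noteq> 0"
  shows "\<exists>z\<in>alg_spectrum b. norm b \<le> cmod z"
proof (rule ccontr)
  assume "\<not> ?thesis"
  then have small: "\<And>z. z \<in> alg_spectrum b \<Longrightarrow> cmod z < norm b" by force
  define \<rho> where "\<rho> = 1 / norm b"
  have \<rho>: "\<rho> > 0" using nz by (simp add: \<rho>_def)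
  define X where "X = cball (0::complex) \<rho>"
  have "\<exists>y. inverses (1 - w *\<^sub>C b) y" if w: "w \<in> X" for w
  proof (cases "w = 0")
    case True
    then show ?thesis by (intro exI[of _ 1]) (simp add: inverses_def)
  next
    case False
    have "norm b \<le> cmod (inverse w)"
      using w False nz by (simp add: X_def \<rho>_def norm_inverse norm_divide field_simps)
    then have "inverse w \<notin> alg_spectrum b" using small[of "inverse w"] by linarith
    then obtain y where "inverses (b - inverse w *\<^sub>C 1) y" by (auto simp: alg_spectrum_iff)
    then have "inverses ((- w) *\<^sub>C (b - inverse w *\<^sub>C 1)) (inverse (- w) *\<^sub>C y)"
      using False by (intro inverses_scaleC) auto
    moreover have "(- w) *\<^sub>C (b - inverse w *\<^sub>C 1) = 1 - w *\<^sub>C b"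
      using False by (simp add: scaleC_diff_right scaleC_scaleC scaleC_minus_left)
    ultimately show ?thesis by auto
  qed
  then obtain R where R: "\<And>w. w \<in> X \<Longrightarrow> inverses (1 - w *\<^sub>C b) (R w)" by metis
  have "uniformly_continuous_on X R"
    by (intro compact_uniformly_continuous resolvent_continuous[OF R]) (auto simp: X_def)
  \<comment> \<open>The bound 1/12 is chosen for the end of the proof: together with
    \<open>norm (G w - 1) \<le> 1/4\<close> at an interior point it gives
    \<open>norm (G v - 1) \<le> 1/3\<close> on the boundary, and any value below 1/2 there is
    contradictory. The same \<delta> then serves for every \<open>m\<close>.\<close>
  then obtain \<delta> where \<delta>: "\<delta> > 0"
    and modR: "\<And>v w. v \<in> X \<Longrightarrow> w \<in> X \<Longrightarrow> dist v w < \<delta> \<Longrightarrow> norm (R v - R w) \<le> 1/12"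
    unfolding uniformly_continuous_on_def dist_norm
    by (metis less_eq_real_def zero_less_divide_1_iff zero_less_numeral)
  have "\<exists>G. (\<forall>w\<in>X. inverses (1 - (w ^ 2 ^ m) *\<^sub>C b ^ 2 ^ m) (G w)) \<and>
    (\<forall>v\<in>X. \<forall>w\<in>X. dist v w < \<delta> \<longrightarrow> norm (G v - G w) \<le> 1/12)" for m
  proof (induction m)
    case 0
    show ?case using R modR by (intro exI[of _ R]) auto
  next
    case (Suc m)
    then obtain G where G: "\<And>w. w \<in> X \<Longrightarrow> inverses (1 - (w ^ 2 ^ m) *\<^sub>C b ^ 2 ^ m) (G w)"
      and modG: "\<And>v w. v \<in> X \<Longrightarrow> w \<in> X \<Longrightarrow> dist v w < \<delta> \<Longrightarrow> norm (G v - G w) \<le> 1/12"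
      by blast
    define \<zeta> where "\<zeta> = cis (pi / 2 ^ m)"
    have "\<zeta> ^ 2 ^ m = cis pi" by (simp add: \<zeta>_def Complex.DeMoivre)
    then have \<zeta>: "\<zeta> ^ 2 ^ m = -1" by simp
    have n\<zeta>: "cmod \<zeta> = 1" by (simp add: \<zeta>_def)
    have X\<zeta>: "\<zeta> * w \<in> X" if "w \<in> X" for w using that n\<zeta> by (simp add: X_def norm_mult)
    define G' where "G' w = (1/2) *\<^sub>R (G w + G (\<zeta> * w))" for w
    \<comment> \<open>Rotating \<open>w\<close> by \<zeta> changes the sign of \<open>u\<close>, so
      the two values averaged in \<open>G'\<close> are the inverses of \<open>1 - u\<close> and
      \<open>1 + u\<close>. Since \<zeta> has modulus 1, the rotation preserves the disc and all
      distances, and so the bound 1/12.\<close>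
    have "inverses (1 - (w ^ 2 ^ Suc m) *\<^sub>C b ^ 2 ^ Suc m) (G' w)" if w: "w \<in> X" for w
    proof -
      define u where "u = (w ^ 2 ^ m) *\<^sub>C b ^ 2 ^ m"
      have "inverses (1 - u) (G w)" using G[OF w] by (simp add: u_def)
      moreover have "inverses (1 + u) (G (\<zeta> * w))"
        using G[OF X\<zeta>[OF w]] by (simp add: u_def power_mult_distrib \<zeta> scaleC_minus_left)
      moreover have "u * u = (w ^ 2 ^ Suc m) *\<^sub>C b ^ 2 ^ Suc m"
        by (simp add: u_def mult_scaleC_left mult_scaleC_right scaleC_scaleC mult_2 power_add)
      ultimately show ?thesis using inverses_halving[of u] by (simp add: G'_def)
    qed
    moreover have "norm (G' v - G' w) \<le> 1/12" if vw: "v \<in> X" "w \<in> X" "dist v w < \<delta>" for v w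
    proof -
      have "dist (\<zeta> * v) (\<zeta> * w) < \<delta>"
        using vw n\<zeta> by (simp add: dist_norm norm_mult flip: right_diff_distrib)
      then have *: "norm (G (\<zeta> * v) - G (\<zeta> * w)) \<le> 1/12" using vw by (intro modG X\<zeta>)
      have "G' v - G' w = (1/2) *\<^sub>R ((G v - G w) + (G (\<zeta> * v) - G (\<zeta> * w)))"
        by (simp add: G'_def algebra_simps)
      then have "norm (G' v - G' w) = norm ((G v - G w) + (G (\<zeta> * v) - G (\<zeta> * w))) / 2" by simp
      also have "\<dots> \<le> (norm (G v - G w) + norm (G (\<zeta> * v) - G (\<zeta> * w))) / 2"
        by (intro divide_right_mono norm_triangle_ineq) simp
      also have "\<dots> \<le> 1/12" using * modG[OF vw] by simp
      finally show ?thesis .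
    qed
    ultimately show ?case by (intro exI[of _ G']) blast
  qed
  note G_ex = this
  \<comment> \<open>The interior point \<open>r * \<rho>\<close> must be closer than \<delta> to the
    boundary point \<rho>; the minimum with 1/2 keeps \<open>r\<close> positive.\<close>
  define r where "r = 1 - min (1/2) (\<delta> / (2 * \<rho>))"
  have r: "0 < r" "r < 1" using \<delta> \<rho> by (auto simp: r_def)
  have r': "(1 - r) * \<rho> < \<delta>"
  proof -
    have "(1 - r) * \<rho> \<le> \<delta> / (2 * \<rho>) * \<rho>" using \<rho> by (intro mult_right_mono) (auto simp: r_def)
    also have "\<dots> < \<delta>" using \<rho> \<delta> by simp
    finally show ?thesis .
  qed
  \<comment> \<open>With \<open>norm c' \<le> 1/5\<close>, the quantity
    \<open>norm (G w - 1)\<close> is at most 1/5 plus 1/5 of itself, that is at most 1/4.\<close>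
  obtain m where m: "r ^ m \<le> 1/5"
    using real_arch_pow_inv[of "1/5" r] r by (auto intro: less_imp_le)
  have "r ^ 2 ^ m \<le> r ^ m" using r less_exp[of m] by (intro power_decreasing) auto
  with m have m2: "r ^ 2 ^ m \<le> 1/5" by linarith
  obtain G where G: "\<And>w. w \<in> X \<Longrightarrow> inverses (1 - (w ^ 2 ^ m) *\<^sub>C b ^ 2 ^ m) (G w)"
    and modG: "\<And>v w. v \<in> X \<Longrightarrow> w \<in> X \<Longrightarrow> dist v w < \<delta> \<Longrightarrow> norm (G v - G w) \<le> 1/12"
    using G_ex by blast
  define v w where "v = complex_of_real \<rho>" and "w = complex_of_real (r * \<rho>)"
  have vw: "v \<in> X" "w \<in> X" using r \<rho> by (simp_all add: X_def v_def w_def norm_mult mult_le_cancel_right1)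
  have "dist v w = cmod (complex_of_real ((1 - r) * \<rho>))"
    by (simp add: v_def w_def dist_norm algebra_simps)
  then have "dist v w < \<delta>" using r r' \<rho> by (simp only: norm_of_real) simp
  then have G12: "norm (G v - G w) \<le> 1/12" by (intro modG vw)
  define c c' where "c = (v ^ 2 ^ m) *\<^sub>C b ^ 2 ^ m" and "c' = (w ^ 2 ^ m) *\<^sub>C b ^ 2 ^ m"
  have nc: "norm c = 1"
    using nz by (simp add: c_def v_def norm_scaleC norm_power norm_selfadjoint_power[OF sa]
        \<rho>_def norm_divide power_divide)
  have "norm c' = r ^ 2 ^ m"
    using nz \<rho> r by (simp add: c'_def w_def norm_scaleC norm_power norm_selfadjoint_power[OF sa]
        norm_mult norm_divide power_mult_distrib \<rho>_def power_divide)
  with m2 have nc': "norm c' \<le> 1/5" by simp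
  have "G w * (1 - c') = 1" "G v * (1 - c) = 1"
    using G[OF vw(1)] G[OF vw(2)] by (simp_all add: c_def c'_def inverses_def)
  then have Gw: "G w - 1 = c' + (G w - 1) * c'" and Gv: "c = (G v - 1) - (G v - 1) * c"
    by (simp_all add: algebra_simps)
  have "norm (G w - 1) \<le> norm c' + norm (G w - 1) * norm c'"
    by (subst Gw) (metis norm_mult_ineq norm_triangle_le add_left_mono)
  also have "\<dots> \<le> 1/5 + norm (G w - 1) * (1/5)"
    using nc' by (intro add_mono mult_left_mono) auto
  finally have "norm (G w - 1) \<le> 1/4" by simp
  moreover have "norm (G v - 1) \<le> norm (G v - G w) + norm (G w - 1)"
    by (metis diff_add_cancel norm_triangle_ineq add_diff_eq)
  ultimately have Gv1: "norm (G v - 1) \<le> 1/3" using G12 by linarith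
  have "norm c \<le> norm (G v - 1) + norm ((G v - 1) * c)"
    by (subst Gv) (rule norm_triangle_ineq4)
  also have "\<dots> \<le> norm (G v - 1) + norm (G v - 1) * norm c"
    by (intro add_left_mono norm_mult_ineq)
  \<comment> \<open>As \<open>norm c = 1\<close>, the chain now reads 1 \<le> 1/3 + 1/3.\<close>
  finally show False using Gv1 nc by simp
qed


section \<open>The cone of nonnegative elements\<close>

lemma cstar_nonneg_star: "cstar_nonneg a \<Longrightarrow> star a = a"
  by (simp add: cstar_nonneg_def)

text \<open>The spectrum of \<open>a\<close> lies in [0, t], and the reflection of \<open>a\<close>
  to \<open>t *\<^sub>R 1 - a\<close> maps this interval to itself. The norm of the selfadjoint
  reflected element is attained by its spectrum.\<close>

lemma cstar_nonneg_norm: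
  assumes a: "cstar_nonneg (a :: 'a::cstar_algebra)" and t: "norm a \<le> t"
  shows "norm (t *\<^sub>R 1 - a) \<le> t"
proof (rule ccontr)
  assume *: "\<not> norm (t *\<^sub>R 1 - a) \<le> t"
  have t0: "t \<ge> 0" using t norm_ge_zero[of a] by linarith
  have "star (t *\<^sub>R 1 - a) = t *\<^sub>R 1 - a"
    by (simp add: star_diff star_scaleR cstar_nonneg_star[OF a])
  moreover have "t *\<^sub>R 1 - a \<noteq> 0" using * t0 by auto
  ultimately obtain z where z: "z \<in> alg_spectrum (t *\<^sub>R 1 - a)" "norm (t *\<^sub>R 1 - a) \<le> cmod z"
    using selfadjoint_norm_le_spectrum by blast
  have "z + (- of_real t) \<in> alg_spectrum (t *\<^sub>R 1 - a + (- of_real t) *\<^sub>C 1)"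
    using z(1) spectrum_add_scalar by blast
  also have "t *\<^sub>R 1 - a + (- of_real t) *\<^sub>C 1 = - a"
    by (simp add: scaleR_scaleC scaleC_minus_left)
  finally have s: "of_real t - z \<in> alg_spectrum a"
    using spectrum_minus[of "z + (- of_real t)" a] by simp
  then have "of_real t - z \<in> \<real>" "0 \<le> Re (of_real t - z)"
    using a by (auto simp: cstar_nonneg_def)
  moreover have "cmod (of_real t - z) \<le> t" using spectrum_norm_le[OF s] t by linarith
  ultimately have "Im z = 0" "0 \<le> t - Re z" "t - Re z \<le> t"
    using complex_Re_le_cmod[of "of_real t - z"] by (auto simp: complex_is_Real_iff)
  then have "cmod z \<le> t" by (simp add: cmod_eq_Re)
  with z * show False by linarith
qed

text \<open>The converse norm criterion, for any \<open>t\<close>: the spectrum lies in the disc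
  with centre and radius \<open>t\<close>, which is contained in the right half plane, and it is
  real because \<open>a\<close> is selfadjoint.\<close>

lemma cstar_nonnegI:
  assumes sa: "star a = (a :: 'a::cstar_algebra)" and t: "norm (t *\<^sub>R 1 - a) \<le> t"
  shows "cstar_nonneg a"
  unfolding cstar_nonneg_def
proof (intro conjI ballI sa)
  fix z assume z: "z \<in> alg_spectrum a"
  then show zr: "z \<in> \<real>" by (rule spectrum_selfadjoint_real[OF sa])
  have "z + (- of_real t) \<in> alg_spectrum (a + (- of_real t) *\<^sub>C 1)"
    using z spectrum_add_scalar by blast
  also have "a + (- of_real t) *\<^sub>C 1 = a - t *\<^sub>R 1" by (simp add: scaleR_scaleC scaleC_minus_left)
  finally have "cmod (z + (- of_real t)) \<le> norm (a - t *\<^sub>R 1)" by (rule spectrum_norm_le)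
  also have "\<dots> \<le> t" using t by (simp add: norm_minus_commute)
  finally have "cmod (z - of_real t) \<le> t" by simp
  then show "0 \<le> Re z" using abs_Re_le_cmod[of "z - of_real t"] by simp
qed

lemma cstar_nonneg_zero [simp]: "cstar_nonneg (0 :: 'a::cstar_algebra)"
  by (rule cstar_nonnegI[where t = 0]) simp_all

text \<open>In terms of the norm criterion this is the triangle inequality, with the radii
  \<open>norm a\<close> and \<open>norm b\<close> added.\<close>

lemma cstar_nonneg_add:
  assumes a: "cstar_nonneg (a :: 'a::cstar_algebra)" and b: "cstar_nonneg b"
  shows "cstar_nonneg (a + b)"
proof (rule cstar_nonnegI)
  show "star (a + b) = a + b" using a b by (simp add: star_add cstar_nonneg_star)
  have "(norm a + norm b) *\<^sub>R 1 - (a + b) = (norm a *\<^sub>R 1 - a) + (norm b *\<^sub>R 1 - b)"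
    by (simp add: algebra_simps)
  also have "norm \<dots> \<le> norm a + norm b"
    by (intro norm_triangle_le add_mono cstar_nonneg_norm a b order_refl)
  finally show "norm ((norm a + norm b) *\<^sub>R 1 - (a + b)) \<le> norm a + norm b" .
qed

lemma cstar_nonneg_scaleR:
  assumes a: "cstar_nonneg (a :: 'a::cstar_algebra)" and r: "r \<ge> 0"
  shows "cstar_nonneg (r *\<^sub>R a)"
proof (rule cstar_nonnegI)
  show "star (r *\<^sub>R a) = r *\<^sub>R a" using a by (simp add: star_scaleR cstar_nonneg_star)
  have "(r * norm a) *\<^sub>R 1 - r *\<^sub>R a = r *\<^sub>R (norm a *\<^sub>R 1 - a)" by (simp add: algebra_simps)
  also have "norm \<dots> \<le> r * norm a"
    using cstar_nonneg_norm[OF a order_refl] r by (simp add: mult_left_mono)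
  finally show "norm ((r * norm a) *\<^sub>R 1 - r *\<^sub>R a) \<le> r * norm a" .
qed

text \<open>Taking \<open>t = norm a\<close> in the norm criterion describes the cone by an equation
  and an inequality between continuous functions.\<close>

lemma closed_cstar_nonneg: "closed {a :: 'a::cstar_algebra. cstar_nonneg a}"
proof -
  have "{a :: 'a. cstar_nonneg a} = {a. star a = a \<and> norm (norm a *\<^sub>R 1 - a) \<le> norm a}"
    by (intro Collect_cong iffI conjI cstar_nonneg_star cstar_nonneg_norm order_refl)
      (auto intro: cstar_nonnegI)
  also have "closed \<dots>"
    by (intro closed_Collect_conj closed_Collect_eq closed_Collect_le continuous_intros
        linear_continuous_on bounded_linear_star)
  finally show ?thesis .
qed

text \<open>The spectrum of \<open>a\<close> would consist of reals that are both nonnegative and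
  nonpositive, yet it contains a point of modulus at least \<open>norm a\<close>.\<close>

lemma cstar_nonneg_antisym:
  assumes a: "cstar_nonneg (a :: 'a::cstar_algebra)" and m: "cstar_nonneg (- a)"
  shows "a = 0"
proof (rule ccontr)
  assume nz: "a \<noteq> 0"
  then obtain z where z: "z \<in> alg_spectrum a" "norm a \<le> cmod z"
    using selfadjoint_norm_le_spectrum[OF cstar_nonneg_star[OF a]] by blast
  then have "z \<in> \<real>" "0 \<le> Re z" using a by (auto simp: cstar_nonneg_def)
  moreover have "- z \<in> alg_spectrum (- a)" using spectrum_minus[of z "- a"] z(1) by simp
  then have "0 \<le> Re (- z)" using m by (auto simp: cstar_nonneg_def)
  ultimately have "z = 0" by (auto simp: complex_is_Real_iff complex_eq_iff)
  with z nz show False by simp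
qed


section \<open>Strongly measurable functions\<close>

text \<open>In a non-separable space an open set of pairs need not be a countable union of open
  rectangles, so measurability of the pair cannot be composed with addition. The countable sets
  \<open>D\<close> and \<open>E\<close> replace a countable base: the preimage of an open set is a
  countable union of the sets \<open>?near d e n\<close>, on which \<open>f\<close> and
  \<open>g\<close> are close to \<open>d\<close> and \<open>e\<close>.\<close>

lemma strongly_measurable_add:
  fixes f g :: "'w \<Rightarrow> 'b::real_normed_vector"
  assumes f: "strongly_measurable M f" and g: "strongly_measurable M g"
  shows "strongly_measurable M (\<lambda>x. f x + g x)"
proof -
  obtain D where D: "countable D" "f ` space M \<subseteq> closure D" and fm: "f \<in> borel_measurable M"
    using f by (auto simp: strongly_measurable_def)
  obtain E where E: "countable E" "g ` space M \<subseteq> closure E" and gm: "g \<in> borel_measurable M"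
    using g by (auto simp: strongly_measurable_def)
  let ?near = "\<lambda>d e n. (f -` ball d (inverse (real (Suc n))) \<inter> space M) \<inter>
    (g -` ball e (inverse (real (Suc n))) \<inter> space M)"
  have near: "\<exists>d\<in>D. \<exists>e\<in>E. x \<in> ?near d e n" if "x \<in> space M" for x n
  proof -
    have pos: "0 < inverse (real (Suc n))" by simp
    have "f x \<in> closure D" "g x \<in> closure E" using that D E by auto
    then obtain d e where "d \<in> D" "dist d (f x) < inverse (real (Suc n))"
      "e \<in> E" "dist e (g x) < inverse (real (Suc n))"
      using pos unfolding closure_approachable by blast
    then show ?thesis using that by auto
  qed
  have near_dist: "dist (f x + g x) (d + e) < 2 * inverse (real (Suc n))"
    if "x \<in> ?near d e n" for x d e n
    using that dist_triangle_add[of "f x" "g x" d e] by (auto simp: dist_commute)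
  have "(\<lambda>x. f x + g x) \<in> borel_measurable M"
  proof (rule borel_measurableI)
    fix U :: "'b set" assume U: "open U"
    define I where "I = {(d, e, n). d \<in> D \<and> e \<in> E \<and> ball (d + e) (2 * inverse (real (Suc n))) \<subseteq> U}"
    have "countable I"
      by (rule countable_subset[of _ "D \<times> E \<times> UNIV"]) (auto simp: I_def D E)
    moreover have "(\<lambda>x. f x + g x) -` U \<inter> space M = (\<Union>(d, e, n)\<in>I. ?near d e n)"
    proof (intro equalityI subsetI)
      fix x assume x: "x \<in> (\<lambda>x. f x + g x) -` U \<inter> space M"
      then obtain r where r: "r > 0" "ball (f x + g x) r \<subseteq> U"
        using U openE by blast
      \<comment> \<open>The sum at \<open>x\<close> is within twice
        \<open>inverse (real (Suc n))\<close> of \<open>d + e\<close>, and the ball around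
        \<open>d + e\<close> has that same radius, so its points are within four times this
        number.\<close>
      obtain n where n: "inverse (real (Suc n)) < r / 4"
        using r(1) reals_Archimedean[of "r/4"] by auto
      obtain d e where de: "d \<in> D" "e \<in> E" "x \<in> ?near d e n" using near x by blast
      have "ball (d + e) (2 * inverse (real (Suc n))) \<subseteq> ball (f x + g x) r"
      proof
        fix y assume "y \<in> ball (d + e) (2 * inverse (real (Suc n)))"
        then have "dist (f x + g x) y < 4 * inverse (real (Suc n))"
          using near_dist[OF de(3)] dist_triangle[of "f x + g x" y "d + e"] by simp
        then show "y \<in> ball (f x + g x) r" using n by simp
      qed
      with r de have "(d, e, n) \<in> I" by (auto simp: I_def)
      with de show "x \<in> (\<Union>(d, e, n)\<in>I. ?near d e n)" by blast
    next
      fix x assume "x \<in> (\<Union>(d, e, n)\<in>I. ?near d e n)"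
      then obtain d e n where "(d, e, n) \<in> I" "x \<in> ?near d e n" by blast
      then show "x \<in> (\<lambda>x. f x + g x) -` U \<inter> space M"
        using near_dist by (auto simp: I_def dist_commute subset_iff)
    qed
    moreover have "?near d e n \<in> sets M" for d e n
      by (intro sets.Int measurable_sets[OF fm] measurable_sets[OF gm]) auto
    ultimately show "(\<lambda>x. f x + g x) -` U \<inter> space M \<in> sets M"
      by (auto intro!: sets.countable_UN')
  qed
  moreover have "f x + g x \<in> closure ((\<lambda>(d, e). d + e) ` (D \<times> E))" if x: "x \<in> space M" for x
    unfolding closure_approachable
  proof (intro allI impI)
    fix r :: real assume "r > 0"
    then obtain n where n: "inverse (real (Suc n)) < r / 2"
      using reals_Archimedean[of "r/2"] by auto
    obtain d e where de: "d \<in> D" "e \<in> E" "x \<in> ?near d e n" using near x by blast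
    then show "\<exists>y\<in>(\<lambda>(d, e). d + e) ` (D \<times> E). dist y (f x + g x) < r"
      using near_dist[OF de(3)] n by (intro bexI[of _ "d + e"]) (auto simp: dist_commute)
  qed
  moreover have "countable ((\<lambda>(d, e). d + e) ` (D \<times> E))" using D E by auto
  ultimately show ?thesis unfolding strongly_measurable_def by blast
qed

lemma strongly_measurable_continuous:
  assumes T: "continuous_on UNIV T" and f: "strongly_measurable M f"
  shows "strongly_measurable M (\<lambda>x. T (f x))"
proof -
  obtain D where D: "countable D" "f ` space M \<subseteq> closure D" and fm: "f \<in> borel_measurable M"
    using f by (auto simp: strongly_measurable_def)
  have "(\<lambda>x. T (f x)) \<in> borel_measurable M"
    using measurable_compose[OF fm borel_measurable_continuous_onI[OF T]] .
  moreover have "T ` closure D \<subseteq> closure (T ` D)"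
    by (intro image_closure_subset continuous_on_subset[OF T] closure_subset) auto
  then have "(\<lambda>x. T (f x)) ` space M \<subseteq> closure (T ` D)" using D by auto
  ultimately show ?thesis 
    unfolding strongly_measurable_def using D(1) by (intro conjI exI[of _ "T ` D"] countable_image)
qed

lemma strongly_measurable_diff:
  fixes f g :: "'w \<Rightarrow> 'b::real_normed_vector"
  assumes "strongly_measurable M f" "strongly_measurable M g"
  shows "strongly_measurable M (\<lambda>x. f x - g x)"
proof -
  have "strongly_measurable M (\<lambda>x. - g x)"
    by (rule strongly_measurable_continuous[OF _ assms(2)]) (intro continuous_intros)
  from strongly_measurable_add[OF assms(1) this] show ?thesis by simp
qed

lemma strongly_measurable_simple:
  assumes "simple_function M s"
  shows "strongly_measurable M s"
proof -
  have "s \<in> borel_measurable M"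
    using measurable_compose[OF measurable_simple_function[OF assms], of "\<lambda>x. x" borel] by simp
  moreover have "countable (s ` space M)"
    using assms by (simp add: simple_function_def countable_finite)
  ultimately show ?thesis
    unfolding strongly_measurable_def by (intro conjI exI[of _ "s ` space M"] closure_subset)
qed

lemma strongly_measurable_cong:
  assumes "\<And>x. x \<in> space M \<Longrightarrow> f x = g x"
  shows "strongly_measurable M f \<longleftrightarrow> strongly_measurable M g"
proof -
  have "f \<in> borel_measurable M \<longleftrightarrow> g \<in> borel_measurable M"
    by (rule measurable_cong[OF assms])
  moreover have "f ` space M = g ` space M"
    by (rule image_cong[OF refl assms])
  ultimately show ?thesis by (simp add: strongly_measurable_def)
qed


section \<open>Vector-valued integrals\<close>

lemma simple_bochner_integrable_simple:
  "Bochner_Integration.simple_bochner_integrable M s \<Longrightarrow> simple_function M s"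
  by (auto elim: Bochner_Integration.simple_bochner_integrable.cases)

text \<open>Additivity and homogeneity of the nonnegative integral require this measurability of the
  approximation errors.\<close>

lemma measurable_norm_diff_simple:
  assumes "strongly_measurable M f" "Bochner_Integration.simple_bochner_integrable M s"
  shows "(\<lambda>x. ennreal (norm (f x - s x))) \<in> borel_measurable M"
proof -
  have "strongly_measurable M (\<lambda>x. f x - s x)"
    by (intro strongly_measurable_diff assms strongly_measurable_simple
        simple_bochner_integrable_simple)
  then have "(\<lambda>x. norm (f x - s x)) \<in> borel_measurable M"
    using strongly_measurable_continuous[of norm] continuous_on_norm_id
    by (auto simp: strongly_measurable_def)
  then show ?thesis by measurable
qed

lemma has_vec_integralE:
  assumes "has_vec_integral M f x"
  obtains s where "strongly_measurable M f"
    "\<And>i. Bochner_Integration.simple_bochner_integrable M (s i)"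
    "(\<lambda>i. \<integral>\<^sup>+ \<xi>. norm (f \<xi> - s i \<xi>) \<partial>M) \<longlonglongrightarrow> 0"
    "(\<lambda>i. Bochner_Integration.simple_bochner_integral M (s i)) \<longlonglongrightarrow> x"
proof -
  from assms have "strongly_measurable M f"
    "\<exists>s. (\<forall>i. Bochner_Integration.simple_bochner_integrable M (s i)) \<and>
      (\<lambda>i. \<integral>\<^sup>+ \<xi>. norm (f \<xi> - s i \<xi>) \<partial>M) \<longlonglongrightarrow> 0 \<and>
      (\<lambda>i. Bochner_Integration.simple_bochner_integral M (s i)) \<longlonglongrightarrow> x"
    unfolding has_vec_integral_def by simp_all
  then show thesis by (elim exE conjE) (rule that, simp_all)
qed

lemma has_vec_integralI:
  assumes "strongly_measurable M f"
    "\<And>i. Bochner_Integration.simple_bochner_integrable M (s i)"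
    "(\<lambda>i. \<integral>\<^sup>+ \<xi>. norm (f \<xi> - s i \<xi>) \<partial>M) \<longlonglongrightarrow> 0"
    "(\<lambda>i. Bochner_Integration.simple_bochner_integral M (s i)) \<longlonglongrightarrow> x"
  shows "has_vec_integral M f x"
proof -
  have "(\<forall>i. Bochner_Integration.simple_bochner_integrable M (s i)) \<and>
      (\<lambda>i. \<integral>\<^sup>+ \<xi>. norm (f \<xi> - s i \<xi>) \<partial>M) \<longlonglongrightarrow> 0 \<and>
      (\<lambda>i. Bochner_Integration.simple_bochner_integral M (s i)) \<longlonglongrightarrow> x"
    using assms by simp
  then show ?thesis unfolding has_vec_integral_def by (intro conjI[OF assms(1)]) (rule exI)
qed

lemma ennreal_tendsto_0_mono:
  fixes f g :: "nat \<Rightarrow> ennreal"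
  assumes "\<And>i. f i \<le> g i" "g \<longlonglongrightarrow> 0"
  shows "f \<longlonglongrightarrow> 0"
  by (rule tendsto_sandwich[OF _ _ tendsto_const assms(2)]) (simp_all add: assms(1))

lemma has_vec_integral_cong:
  assumes "\<And>x. x \<in> space M \<Longrightarrow> f x = g x"
  shows "has_vec_integral M f x \<longleftrightarrow> has_vec_integral M g x"
proof -
  have "(\<integral>\<^sup>+ \<xi>. norm (f \<xi> - s \<xi>) \<partial>M) = (\<integral>\<^sup>+ \<xi>. norm (g \<xi> - s \<xi>) \<partial>M)" for s
    by (rule nn_integral_cong) (simp add: assms)
  moreover have "strongly_measurable M f \<longleftrightarrow> strongly_measurable M g"
    by (rule strongly_measurable_cong[OF assms])
  ultimately show ?thesis by (simp only: has_vec_integral_def)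
qed

lemma has_vec_integral_add:
  assumes "has_vec_integral M f x" "has_vec_integral M g y"
  shows "has_vec_integral M (\<lambda>\<xi>. f \<xi> + g \<xi>) (x + y)"
proof -
  obtain s where f: "strongly_measurable M f"
    and s: "\<And>i. Bochner_Integration.simple_bochner_integrable M (s i)"
      "(\<lambda>i. \<integral>\<^sup>+ \<xi>. norm (f \<xi> - s i \<xi>) \<partial>M) \<longlonglongrightarrow> 0"
      "(\<lambda>i. Bochner_Integration.simple_bochner_integral M (s i)) \<longlonglongrightarrow> x"
    using has_vec_integralE[OF assms(1)] by metis
  obtain t where g: "strongly_measurable M g"
    and t: "\<And>i. Bochner_Integration.simple_bochner_integrable M (t i)"
      "(\<lambda>i. \<integral>\<^sup>+ \<xi>. norm (g \<xi> - t i \<xi>) \<partial>M) \<longlonglongrightarrow> 0"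
      "(\<lambda>i. Bochner_Integration.simple_bochner_integral M (t i)) \<longlonglongrightarrow> y"
    using has_vec_integralE[OF assms(2)] by metis
  let ?st = "\<lambda>i \<xi>. s i \<xi> + t i \<xi>"
  have "(\<integral>\<^sup>+ \<xi>. norm (f \<xi> + g \<xi> - ?st i \<xi>) \<partial>M)
      \<le> (\<integral>\<^sup>+ \<xi>. norm (f \<xi> - s i \<xi>) \<partial>M) + (\<integral>\<^sup>+ \<xi>. norm (g \<xi> - t i \<xi>) \<partial>M)" for i
  proof -
    have "(\<integral>\<^sup>+ \<xi>. norm (f \<xi> + g \<xi> - ?st i \<xi>) \<partial>M)
        \<le> (\<integral>\<^sup>+ \<xi>. ennreal (norm (f \<xi> - s i \<xi>)) + ennreal (norm (g \<xi> - t i \<xi>)) \<partial>M)"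
      by (intro nn_integral_mono) (simp add: norm_diff_triangle_ineq flip: ennreal_plus)
    also have "\<dots> = (\<integral>\<^sup>+ \<xi>. norm (f \<xi> - s i \<xi>) \<partial>M) + (\<integral>\<^sup>+ \<xi>. norm (g \<xi> - t i \<xi>) \<partial>M)"
      by (intro nn_integral_add measurable_norm_diff_simple f g s t)
    finally show ?thesis .
  qed
  moreover have "(\<lambda>i. (\<integral>\<^sup>+ \<xi>. norm (f \<xi> - s i \<xi>) \<partial>M) + (\<integral>\<^sup>+ \<xi>. norm (g \<xi> - t i \<xi>) \<partial>M)) \<longlonglongrightarrow> 0"
    using tendsto_add[OF s(2) t(2)] by simp
  ultimately have "(\<lambda>i. \<integral>\<^sup>+ \<xi>. norm (f \<xi> + g \<xi> - ?st i \<xi>) \<partial>M) \<longlonglongrightarrow> 0"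
    by (rule ennreal_tendsto_0_mono)
  moreover have "(\<lambda>i. Bochner_Integration.simple_bochner_integral M (?st i)) \<longlonglongrightarrow> x + y"
    using tendsto_add[OF s(3) t(3)] by (simp add: simple_bochner_integral_add s t)
  moreover have "Bochner_Integration.simple_bochner_integrable M (?st i)" for i
    by (rule simple_bochner_integrable_compose2[OF _ s(1) t(1)]) simp
  ultimately show ?thesis
    by (rule has_vec_integralI[where s = ?st, OF strongly_measurable_add[OF f g], rotated])
qed

lemma has_vec_integral_bounded_linear:
  assumes T: "bounded_linear T" and "has_vec_integral M f x"
  shows "has_vec_integral M (\<lambda>\<xi>. T (f \<xi>)) (T x)"
proof -
  interpret T: bounded_linear T by (rule T)
  obtain s where f: "strongly_measurable M f"
    and s: "\<And>i. Bochner_Integration.simple_bochner_integrable M (s i)"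
      "(\<lambda>i. \<integral>\<^sup>+ \<xi>. norm (f \<xi> - s i \<xi>) \<partial>M) \<longlonglongrightarrow> 0"
      "(\<lambda>i. Bochner_Integration.simple_bochner_integral M (s i)) \<longlonglongrightarrow> x"
    using has_vec_integralE[OF assms(2)] by metis
  obtain C where C: "C > 0" "\<And>x. norm (T x) \<le> norm x * C" using T.pos_bounded by blast
  have "(\<integral>\<^sup>+ \<xi>. norm (T (f \<xi>) - T (s i \<xi>)) \<partial>M) \<le> ennreal C * (\<integral>\<^sup>+ \<xi>. norm (f \<xi> - s i \<xi>) \<partial>M)" for i
  proof -
    have "(\<integral>\<^sup>+ \<xi>. norm (T (f \<xi>) - T (s i \<xi>)) \<partial>M)
        \<le> (\<integral>\<^sup>+ \<xi>. ennreal C * ennreal (norm (f \<xi> - s i \<xi>)) \<partial>M)"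
      using C by (intro nn_integral_mono)
        (simp add: mult.commute flip: T.diff ennreal_mult)
    also have "\<dots> = ennreal C * (\<integral>\<^sup>+ \<xi>. norm (f \<xi> - s i \<xi>) \<partial>M)"
      by (intro nn_integral_cmult measurable_norm_diff_simple f s)
    finally show ?thesis .
  qed
  moreover have "(\<lambda>i. ennreal C * (\<integral>\<^sup>+ \<xi>. norm (f \<xi> - s i \<xi>) \<partial>M)) \<longlonglongrightarrow> 0"
    using ennreal_tendsto_cmult[OF _ s(2), of "ennreal C"] by simp
  ultimately have "(\<lambda>i. \<integral>\<^sup>+ \<xi>. norm (T (f \<xi>) - T (s i \<xi>)) \<partial>M) \<longlonglongrightarrow> 0"
    by (rule ennreal_tendsto_0_mono)
  moreover have "(\<lambda>i. Bochner_Integration.simple_bochner_integral M (\<lambda>\<xi>. T (s i \<xi>))) \<longlonglongrightarrow> T x"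
    using T.tendsto[OF s(3)] by (simp add: simple_bochner_integral_linear T.linear_axioms s)
  moreover have "Bochner_Integration.simple_bochner_integrable M (\<lambda>\<xi>. T (s i \<xi>))" for i
    by (rule simple_bochner_integrable_compose2[where p = "\<lambda>x y. T x", OF _ s(1) s(1)])
      (simp add: T.zero)
  ultimately show ?thesis
    by (intro has_vec_integralI[where s = "\<lambda>i \<xi>. T (s i \<xi>)"]
        strongly_measurable_continuous[OF T.continuous_on[OF continuous_on_id] f])
qed

lemma has_vec_integral_diff:
  assumes "has_vec_integral M f x" "has_vec_integral M g y"
  shows "has_vec_integral M (\<lambda>\<xi>. f \<xi> - g \<xi>) (x - y)"
  using has_vec_integral_add[OF assms(1) has_vec_integral_bounded_linear[OF bounded_linear_minus[OF
      bounded_linear_ident] assms(2)]] by simp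

text \<open>Moving the values of the approximating simple functions to nearly closest points of the cone
  keeps them simple and at most triples their distance from the integrand.\<close>

lemma has_vec_integral_closed_cone:
  fixes C :: "'b::real_normed_vector set"
  assumes f: "has_vec_integral M f x" and fC: "\<And>\<xi>. \<xi> \<in> space M \<Longrightarrow> f \<xi> \<in> C"
    and C: "closed C" "0 \<in> C" "\<And>a b. a \<in> C \<Longrightarrow> b \<in> C \<Longrightarrow> a + b \<in> C"
      "\<And>r a. a \<in> C \<Longrightarrow> 0 \<le> r \<Longrightarrow> r *\<^sub>R a \<in> C"
  shows "x \<in> C"
proof -
  obtain s where fm: "strongly_measurable M f"
    and s: "\<And>i. Bochner_Integration.simple_bochner_integrable M (s i)"
      "(\<lambda>i. \<integral>\<^sup>+ \<xi>. norm (f \<xi> - s i \<xi>) \<partial>M) \<longlonglongrightarrow> 0"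
      "(\<lambda>i. Bochner_Integration.simple_bochner_integral M (s i)) \<longlonglongrightarrow> x"
    using has_vec_integralE[OF f] by metis
  \<comment> \<open>The infimum defining the distance need not be attained; the factor 2 leaves room
    unless the distance is 0, and then closedness puts \<open>y\<close> itself in
    \<open>C\<close>.\<close>
  have "\<exists>c\<in>C. dist y c \<le> 2 * infdist y C" for y
  proof (cases "infdist y C = 0")
    case True
    then have "y \<in> C" using C in_closed_iff_infdist_zero[of C y] by auto
    then show ?thesis using True by (intro bexI[of _ y]) auto
  next
    case False
    show ?thesis
    proof (rule ccontr)
      assume "\<not> ?thesis"
      then have "2 * infdist y C \<le> dist y c" if "c \<in> C" for c
        using that by force
      then have "2 * infdist y C \<le> (INF c\<in>C. dist y c)"
        using C(2) by (intro cINF_greatest) auto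
      moreover have "infdist y C = (INF c\<in>C. dist y c)"
        using C(2) by (intro infdist_notempty) auto
      ultimately have "2 * infdist y C \<le> infdist y C" by simp
      with False infdist_nonneg[of y C] show False by linarith
    qed
  qed
  then obtain p where p: "\<And>y. p y \<in> C" "\<And>y. dist y (p y) \<le> 2 * infdist y C" by metis
  \<comment> \<open>Simple integrable functions are zero off a set of finite measure, and
    \<open>p\<close> has to preserve this.\<close>
  have p0: "p 0 = 0" using p(2)[of 0] C(2) by simp
  let ?t = "\<lambda>i \<xi>. p (s i \<xi>)"
  have t: "Bochner_Integration.simple_bochner_integrable M (?t i)" for i
    by (rule simple_bochner_integrable_compose2[where p = "\<lambda>x y. p x", OF _ s(1) s(1)]) (rule p0)
  have in_C: "Bochner_Integration.simple_bochner_integral M (?t i) \<in> C" for i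
  proof -
    have "(\<Sum>y\<in>A. measure M {\<xi> \<in> space M. ?t i \<xi> = y} *\<^sub>R y) \<in> C"
      if "finite A" "A \<subseteq> ?t i ` space M" for A
      using that by (induction A rule: finite_induct) (auto intro!: C p)
    then show ?thesis
      using simple_bochner_integrable_simple[OF t, of i]
      by (auto simp: Bochner_Integration.simple_bochner_integral_def simple_function_def)
  qed
  have bound: "ennreal (norm (Bochner_Integration.simple_bochner_integral M (s i) -
      Bochner_Integration.simple_bochner_integral M (?t i)))
      \<le> 2 * (\<integral>\<^sup>+ \<xi>. norm (f \<xi> - s i \<xi>) \<partial>M)" for i
  proof -
    have d: "Bochner_Integration.simple_bochner_integrable M (\<lambda>\<xi>. s i \<xi> - ?t i \<xi>)"
      "Bochner_Integration.simple_bochner_integrable M (\<lambda>\<xi>. norm (s i \<xi> - ?t i \<xi>))"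
      using simple_bochner_integrable_compose2[of "(-)" M "s i" "?t i"]
        simple_bochner_integrable_compose2[of "\<lambda>x y. norm (x - y)" M "s i" "?t i"] s t by auto
    have "ennreal (norm (Bochner_Integration.simple_bochner_integral M (s i) -
        Bochner_Integration.simple_bochner_integral M (?t i)))
        = norm (Bochner_Integration.simple_bochner_integral M (\<lambda>\<xi>. s i \<xi> - ?t i \<xi>))"
      by (simp add: simple_bochner_integral_diff s t)
    also have "\<dots> \<le> Bochner_Integration.simple_bochner_integral M (\<lambda>\<xi>. norm (s i \<xi> - ?t i \<xi>))"
      by (intro ennreal_leI simple_bochner_integral_norm_bound d)
    also have "\<dots> = (\<integral>\<^sup>+ \<xi>. norm (s i \<xi> - ?t i \<xi>) \<partial>M)"
      by (intro simple_bochner_integral_eq_nn_integral d) simp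
    also have "\<dots> \<le> (\<integral>\<^sup>+ \<xi>. ennreal 2 * ennreal (norm (f \<xi> - s i \<xi>)) \<partial>M)"
    proof (intro nn_integral_mono)
      fix \<xi> assume "\<xi> \<in> space M"
      \<comment> \<open>The value of \<open>f\<close> is itself a point of the cone, so the distance
        to the cone is at most the approximation error.\<close>
      then have "infdist (s i \<xi>) C \<le> norm (f \<xi> - s i \<xi>)"
        using infdist_le[OF fC, of \<xi> "s i \<xi>"] by (simp add: dist_norm norm_minus_commute)
      then have "norm (s i \<xi> - ?t i \<xi>) \<le> 2 * norm (f \<xi> - s i \<xi>)"
        using p(2)[of "s i \<xi>"] by (simp add: dist_norm)
      then show "ennreal (norm (s i \<xi> - ?t i \<xi>)) \<le> ennreal 2 * ennreal (norm (f \<xi> - s i \<xi>))"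
        by (simp add: ennreal_leI flip: ennreal_mult del: ennreal_numeral)
    qed
    also have "\<dots> = ennreal 2 * (\<integral>\<^sup>+ \<xi>. norm (f \<xi> - s i \<xi>) \<partial>M)"
      by (intro nn_integral_cmult measurable_norm_diff_simple fm s)
    finally show ?thesis by simp
  qed
  have "(\<lambda>i. 2 * (\<integral>\<^sup>+ \<xi>. norm (f \<xi> - s i \<xi>) \<partial>M)) \<longlonglongrightarrow> 0"
    using ennreal_tendsto_cmult[OF _ s(2), of 2] by simp
  then have "(\<lambda>i. ennreal (norm (Bochner_Integration.simple_bochner_integral M (s i) -
      Bochner_Integration.simple_bochner_integral M (?t i)))) \<longlonglongrightarrow> 0"
    by (rule ennreal_tendsto_0_mono[OF bound])
  then have "(\<lambda>i. norm (Bochner_Integration.simple_bochner_integral M (s i) -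
      Bochner_Integration.simple_bochner_integral M (?t i))) \<longlonglongrightarrow> 0"
    by (simp add: ennreal_tendsto_0_iff)
  then have "(\<lambda>i. Bochner_Integration.simple_bochner_integral M (s i) -
      Bochner_Integration.simple_bochner_integral M (?t i)) \<longlonglongrightarrow> 0"
    by (simp add: tendsto_norm_zero_iff)
  then have "(\<lambda>i. Bochner_Integration.simple_bochner_integral M (?t i)) \<longlonglongrightarrow> x"
    using tendsto_diff[OF s(3)] by fastforce
  with closed_sequentially[OF C(1)] in_C show ?thesis by metis
qed

text \<open>The difference of two values is an integral of the zero function, hence lies in the
  closed cone \<open>{0}\<close>.\<close>

lemma has_vec_integral_unique:
  assumes "has_vec_integral M f x" "has_vec_integral M f y"
  shows "x = y"
proof -
  have "has_vec_integral M (\<lambda>_. 0) (x - y)"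
    using has_vec_integral_diff[OF assms] by simp
  then have "x - y \<in> {0}" by (rule has_vec_integral_closed_cone) auto
  then show ?thesis by simp
qed

lemma vec_integral_eq: "has_vec_integral M f x \<Longrightarrow> vec_integral M f = x"
  unfolding vec_integral_def 
  by (rule the_equality) (assumption, rule has_vec_integral_unique, assumption, assumption)

lemma has_vec_integral_vec_integral:
  "vec_integrable M f \<Longrightarrow> has_vec_integral M f (vec_integral M f)"
proof -
  assume "vec_integrable M f"
  then obtain x where "has_vec_integral M f x" unfolding vec_integrable_def ..
  then show ?thesis by (simp add: vec_integral_eq)
qed

lemma has_vec_integral_cstar_nonneg:
  assumes "has_vec_integral M f x" "\<And>\<xi>. \<xi> \<in> space M \<Longrightarrow> cstar_nonneg (f \<xi>)"
  shows "cstar_nonneg x"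
proof -
  have "x \<in> {a. cstar_nonneg a}"
    by (rule has_vec_integral_closed_cone[OF assms(1)])
      (auto simp: assms(2) closed_cstar_nonneg cstar_nonneg_add cstar_nonneg_scaleR)
  then show ?thesis by simp
qed


section \<open>Hilbert modules and adjoints\<close>

context hilbert_module
begin

lemma uminus_eq: "x \<in> carrier E \<Longrightarrow> - x = (- 1) \<cdot> x"
  using scaleR_act[of x "- 1"] by simp

lemma uminus_closed: "x \<in> carrier E \<Longrightarrow> - x \<in> carrier E"
  by (simp add: uminus_eq act_closed)

lemma diff_closed: "x \<in> carrier E \<Longrightarrow> y \<in> carrier E \<Longrightarrow> x - y \<in> carrier E"
  using add_closed[OF _ uminus_closed] by fastforce

lemma ip_uminus_left: "x \<in> carrier E \<Longrightarrow> y \<in> carrier E \<Longrightarrow> \<langle>- x, y\<rangle> = - \<langle>x, y\<rangle>"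
  by (simp add: uminus_eq ip_act_left)

lemma ip_diff_left:
  assumes "x \<in> carrier E" "y \<in> carrier E" "z \<in> carrier E"
  shows "\<langle>x - y, z\<rangle> = \<langle>x, z\<rangle> - \<langle>y, z\<rangle>"
  using ip_add_left[of x "- y" z] assms by (simp add: uminus_closed ip_uminus_left)

lemma ip_add_right:
  assumes "x \<in> carrier E" "y \<in> carrier E" "z \<in> carrier E"
  shows "\<langle>x, y + z\<rangle> = \<langle>x, y\<rangle> + \<langle>x, z\<rangle>"
proof -
  have "\<langle>x, y + z\<rangle> = star \<langle>y + z, x\<rangle>" using assms by (simp add: ip_star add_closed)
  also have "\<dots> = \<langle>x, y\<rangle> + \<langle>x, z\<rangle>" using assms by (simp add: ip_add_left star_add ip_star)
  finally show ?thesis .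
qed

lemma ip_act_right:
  assumes "x \<in> carrier E" "y \<in> carrier E"
  shows "\<langle>x, a \<cdot> y\<rangle> = \<langle>x, y\<rangle> * star a"
proof -
  have "\<langle>x, a \<cdot> y\<rangle> = star \<langle>a \<cdot> y, x\<rangle>" using assms by (simp add: ip_star act_closed)
  also have "\<dots> = \<langle>x, y\<rangle> * star a" using assms by (simp add: ip_act_left star_mult ip_star)
  finally show ?thesis .
qed

lemma ip_diff_right:
  assumes "x \<in> carrier E" "y \<in> carrier E" "z \<in> carrier E"
  shows "\<langle>x, y - z\<rangle> = \<langle>x, y\<rangle> - \<langle>x, z\<rangle>"
proof -
  have "\<langle>x, y - z\<rangle> = star \<langle>y - z, x\<rangle>" using assms by (simp add: ip_star diff_closed)
  also have "\<dots> = \<langle>x, y\<rangle> - \<langle>x, z\<rangle>" using assms by (simp add: ip_diff_left star_diff ip_star)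
  finally show ?thesis .
qed

lemma ip_self_nonneg: "x \<in> carrier E \<Longrightarrow> cstar_nonneg \<langle>x, x\<rangle>"
  using ip_nonneg by (simp add: cstar_le_def)

lemma ip_add_self:
  assumes "x \<in> carrier E" "y \<in> carrier E"
  shows "\<langle>x + y, x + y\<rangle> = \<langle>x, x\<rangle> + \<langle>x, y\<rangle> + star \<langle>x, y\<rangle> + \<langle>y, y\<rangle>"
  using assms by (simp add: ip_add_left ip_add_right add_closed ip_star)

text \<open>One expansion for three uses: \<open>c = 1\<close> gives the sum of the two families,
  \<open>c = -1\<close> the parallelogram law, and arbitrary \<open>c\<close> the vanishing of
  pairings with a null vector.\<close>

lemma ip_add_scaled_self:
  assumes "x \<in> carrier E" "y \<in> carrier E"
  shows "\<langle>(c *\<^sub>C 1) \<cdot> x + y, (c *\<^sub>C 1) \<cdot> x + y\<rangle>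
    = (c * cnj c) *\<^sub>C \<langle>x, x\<rangle> + c *\<^sub>C \<langle>x, y\<rangle> + star (c *\<^sub>C \<langle>x, y\<rangle>) + \<langle>y, y\<rangle>"
  using assms
  by (simp add: ip_add_self act_closed ip_act_left ip_act_right star_scaleC mult_scaleC_left
      mult_scaleC_right scaleC_scaleC mult.commute)

lemma ip_left_unique:
  assumes "y \<in> carrier E" "z \<in> carrier E" "\<And>x. x \<in> carrier E \<Longrightarrow> \<langle>x, y\<rangle> = \<langle>x, z\<rangle>"
  shows "y = z"
proof -
  have "\<langle>y - z, y - z\<rangle> = 0"
    using assms by (simp add: ip_diff_right diff_closed)
  then show ?thesis using ip_definite[of "y - z"] assms by (simp add: diff_closed)
qed

end

text \<open>Uniqueness rests on definiteness in \<open>H\<close> alone, so \<open>F\<close> may be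
  the bare record \<open>submod K X\<close>, for which no \<open>hilbert_module\<close> fact is
  established.\<close>

lemma adj_eqI:
  assumes H: "hilbert_module H" and T: "adjoint_pair H F T T'" and y: "y \<in> carrier F"
  shows "adj H F T y = T' y"
proof -
  interpret hilbert_module H by (rule H)
  show ?thesis
    unfolding adj_def
  proof (rule the_equality)
    show "T' y \<in> carrier H \<and> (\<forall>x\<in>carrier H. \<langle>T x, y\<rangle>\<^bsub>F\<^esub> = \<langle>x, T' y\<rangle>\<^bsub>H\<^esub>)"
      using T y by (auto simp: adjoint_pair_def)
    fix z assume "z \<in> carrier H \<and> (\<forall>x\<in>carrier H. \<langle>T x, y\<rangle>\<^bsub>F\<^esub> = \<langle>x, z\<rangle>\<^bsub>H\<^esub>)"
    then show "z = T' y"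
      using T y by (intro ip_left_unique) (auto simp: adjoint_pair_def)
  qed
qed

text \<open>This turns the integrands of \<open>cKg_dual\<close> and \<open>synthesis_op\<close>,
  which contain adjoints, into inner products in \<open>K\<close>, where all cross terms are
  computed.\<close>

lemma ip_adj_left:
  assumes H: "hilbert_module H" and K: "hilbert_module K" and X: "X \<subseteq> carrier K"
    and T: "T \<in> endo_star H (submod K X)" and y: "y \<in> X" and h: "h \<in> carrier H"
  shows "\<langle>adj H (submod K X) T y, h\<rangle>\<^bsub>H\<^esub> = \<langle>y, T h\<rangle>\<^bsub>K\<^esub>"
proof -
  obtain T' where T': "adjoint_pair H (submod K X) T T'" using T by (auto simp: endo_star_def)
  then have "T' y \<in> carrier H" "T h \<in> X" "\<langle>T h, y\<rangle>\<^bsub>K\<^esub> = \<langle>h, T' y\<rangle>\<^bsub>H\<^esub>"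
    using y h by (auto simp: adjoint_pair_def)
  then have "\<langle>T' y, h\<rangle>\<^bsub>H\<^esub> = \<langle>y, T h\<rangle>\<^bsub>K\<^esub>"
    using X y h hilbert_module.ip_star[OF H] hilbert_module.ip_star[OF K] by (metis subsetD)
  then show ?thesis using adj_eqI[OF H T'] y by simp
qed

lemma endo_star_closed: "T \<in> endo_star E F \<Longrightarrow> x \<in> carrier E \<Longrightarrow> T x \<in> carrier F"
  by (auto simp: endo_star_def)

lemma endo_star_add:
  assumes H: "hilbert_module H" and K: "hilbert_module K" and X: "closed_submodule X K"
    and T: "T \<in> endo_star H (submod K X)" and U: "U \<in> endo_star H (submod K X)"
  shows "(\<lambda>h. T h + U h) \<in> endo_star H (submod K X)"
proof -
  interpret H: hilbert_module H by (rule H)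
  interpret K: hilbert_module K by (rule K)
  have sub: "X \<subseteq> carrier K" "\<And>x y. x \<in> X \<Longrightarrow> y \<in> X \<Longrightarrow> x + y \<in> X"
    using X by (auto simp: closed_submodule_def)
  obtain T' U' where T': "adjoint_pair H (submod K X) T T'"
    and U': "adjoint_pair H (submod K X) U U'"
    using T U by (auto simp: endo_star_def)
  have mem: "T h \<in> X" "U h \<in> X" "T h \<in> carrier K" "U h \<in> carrier K" if "h \<in> carrier H" for h
    using endo_star_closed[OF T that] endo_star_closed[OF U that] sub by auto
  have mem': "T' y \<in> carrier H" "U' y \<in> carrier H" "y \<in> carrier K" if "y \<in> X" for y
    using T' U' that sub by (auto simp: adjoint_pair_def)
  have "\<langle>T h + U h, y\<rangle>\<^bsub>K\<^esub> = \<langle>h, T' y + U' y\<rangle>\<^bsub>H\<^esub>" if "h \<in> carrier H" "y \<in> X" for h y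
    using that mem mem' T' U' by (simp add: K.ip_add_left H.ip_add_right adjoint_pair_def)
  then have "adjoint_pair H (submod K X) (\<lambda>h. T h + U h) (\<lambda>y. T' y + U' y)"
    using sub mem mem' by (auto simp: adjoint_pair_def H.add_closed)
  moreover have "T (a \<cdot>\<^bsub>H\<^esub> h) + U (a \<cdot>\<^bsub>H\<^esub> h) = a \<cdot>\<^bsub>K\<^esub> (T h + U h)" if "h \<in> carrier H" for a h
    using that T U mem by (simp add: endo_star_def K.act_add_right)
  moreover have "T (x + y) + U (x + y) = (T x + U x) + (T y + U y)"
    if "x \<in> carrier H" "y \<in> carrier H" for x y
    using that T U by (simp add: endo_star_def)
  ultimately show ?thesis using sub mem by (auto simp: endo_star_def)
qed

lemma op_family_add:
  assumes "hilbert_module H" "hilbert_module K"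
    and "\<And>\<xi>. \<xi> \<in> space \<nu> \<Longrightarrow> closed_submodule (S \<xi>) K"
    and "op_family \<nu> H K S \<Upsilon>" "op_family \<nu> H K S \<Phi>"
  shows "op_family \<nu> H K S (\<lambda>\<xi> h. \<Upsilon> \<xi> h + \<Phi> \<xi> h)"
  using assms by (auto simp: op_family_def intro: endo_star_add strongly_measurable_add)


section \<open>Integrals of inner products\<close>

context hilbert_module
begin

lemma has_vec_integral_ip_swap:
  assumes "\<And>\<xi>. \<xi> \<in> space M \<Longrightarrow> F \<xi> \<in> carrier E" "\<And>\<xi>. \<xi> \<in> space M \<Longrightarrow> G \<xi> \<in> carrier E"
    and "has_vec_integral M (\<lambda>\<xi>. \<langle>F \<xi>, G \<xi>\<rangle>) x"
  shows "has_vec_integral M (\<lambda>\<xi>. \<langle>G \<xi>, F \<xi>\<rangle>) (star x)"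
proof -
  have "has_vec_integral M (\<lambda>\<xi>. star \<langle>F \<xi>, G \<xi>\<rangle>) (star x)"
    by (rule has_vec_integral_bounded_linear[OF bounded_linear_star assms(3)])
  then show ?thesis
    by (rule has_vec_integral_cong[THEN iffD1, rotated]) (simp add: ip_star assms(1,2))
qed

lemma has_vec_integral_ip_add_scaled:
  assumes F: "\<And>\<xi>. \<xi> \<in> space M \<Longrightarrow> F \<xi> \<in> carrier E" and G: "\<And>\<xi>. \<xi> \<in> space M \<Longrightarrow> G \<xi> \<in> carrier E"
    and FF: "has_vec_integral M (\<lambda>\<xi>. \<langle>F \<xi>, F \<xi>\<rangle>) a"
    and FG: "has_vec_integral M (\<lambda>\<xi>. \<langle>F \<xi>, G \<xi>\<rangle>) x"
    and GG: "has_vec_integral M (\<lambda>\<xi>. \<langle>G \<xi>, G \<xi>\<rangle>) b"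
  shows "has_vec_integral M
    (\<lambda>\<xi>. \<langle>(c *\<^sub>C 1) \<cdot> F \<xi> + G \<xi>, (c *\<^sub>C 1) \<cdot> F \<xi> + G \<xi>\<rangle>)
    ((c * cnj c) *\<^sub>C a + c *\<^sub>C x + star (c *\<^sub>C x) + b)"
proof -
  note cx = has_vec_integral_bounded_linear[OF bounded_linear_scaleC FG, of c]
  have "has_vec_integral M
    (\<lambda>\<xi>. (c * cnj c) *\<^sub>C \<langle>F \<xi>, F \<xi>\<rangle> + c *\<^sub>C \<langle>F \<xi>, G \<xi>\<rangle> + star (c *\<^sub>C \<langle>F \<xi>, G \<xi>\<rangle>) + \<langle>G \<xi>, G \<xi>\<rangle>)
    ((c * cnj c) *\<^sub>C a + c *\<^sub>C x + star (c *\<^sub>C x) + b)"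
    by (rule has_vec_integral_add[OF has_vec_integral_add[OF has_vec_integral_add[OF
        has_vec_integral_bounded_linear[OF bounded_linear_scaleC FF] cx]
        has_vec_integral_bounded_linear[OF bounded_linear_star cx]] GG])
  then show ?thesis
    by (rule has_vec_integral_cong[THEN iffD1, rotated]) (simp add: ip_add_scaled_self F G)
qed

lemma ip_integral_nonneg:
  assumes "\<And>\<xi>. \<xi> \<in> space M \<Longrightarrow> F \<xi> \<in> carrier E" "\<And>\<xi>. \<xi> \<in> space M \<Longrightarrow> G \<xi> \<in> carrier E"
    and "has_vec_integral M (\<lambda>\<xi>. \<langle>F \<xi>, F \<xi>\<rangle>) a"
    and "has_vec_integral M (\<lambda>\<xi>. \<langle>F \<xi>, G \<xi>\<rangle>) x"
    and "has_vec_integral M (\<lambda>\<xi>. \<langle>G \<xi>, G \<xi>\<rangle>) b"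
  shows "cstar_nonneg ((c * cnj c) *\<^sub>C a + c *\<^sub>C x + star (c *\<^sub>C x) + b)"
  by (rule has_vec_integral_cstar_nonneg[OF has_vec_integral_ip_add_scaled[OF assms]])
    (auto intro!: ip_self_nonneg add_closed act_closed assms(1,2))

end

text \<open>Dividing by a large positive \<open>t\<close> and passing to the limit shows that the
  direction itself is nonnegative. This applies to both \<open>y\<close> and
  \<open>- y\<close>.\<close>

lemma cstar_nonneg_line:
  fixes b y :: "'a::cstar_algebra"
  assumes "\<And>t. cstar_nonneg (t *\<^sub>R y + b)"
  shows "y = 0"
proof -
  have limit: "cstar_nonneg z" if "\<And>t. cstar_nonneg (t *\<^sub>R z + b)" for z
  proof -
    have lim: "(\<lambda>n. z + inverse (real (Suc n)) *\<^sub>R b) \<longlonglongrightarrow> z + 0 *\<^sub>R b"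
      by (intro tendsto_intros LIMSEQ_inverse_real_of_nat)
    have "z + inverse (real (Suc n)) *\<^sub>R b \<in> {a. cstar_nonneg a}" for n
      using cstar_nonneg_scaleR[OF that[of "real (Suc n)"], of "inverse (real (Suc n))"]
      by (simp add: scaleR_add_right del: of_nat_Suc)
    then have "z + 0 *\<^sub>R b \<in> {a. cstar_nonneg a}"
      by (rule closed_sequentially[OF closed_cstar_nonneg _ lim])
    then show ?thesis by simp
  qed
  have "cstar_nonneg y" by (rule limit[OF assms])
  moreover have "cstar_nonneg (- y)" by (rule limit) (use assms[of "- t" for t] in simp)
  ultimately show ?thesis by (rule cstar_nonneg_antisym)
qed

text \<open>As \<open>F\<close> is a null vector, the integral of \<open>\<langle>c F + G, c F + G\<rangle>\<close> is affine in the complex number \<open>c\<close>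
  and bounded below, hence constant. This needs less than the Cauchy-Schwarz inequality.\<close>

lemma (in hilbert_module) null_ip_integral:
  assumes "\<And>\<xi>. \<xi> \<in> space M \<Longrightarrow> F \<xi> \<in> carrier E" "\<And>\<xi>. \<xi> \<in> space M \<Longrightarrow> G \<xi> \<in> carrier E"
    and "has_vec_integral M (\<lambda>\<xi>. \<langle>F \<xi>, F \<xi>\<rangle>) 0"
    and "has_vec_integral M (\<lambda>\<xi>. \<langle>F \<xi>, G \<xi>\<rangle>) x"
    and "has_vec_integral M (\<lambda>\<xi>. \<langle>G \<xi>, G \<xi>\<rangle>) b"
  shows "x = 0"
proof -
  have zero: "c *\<^sub>C x + star (c *\<^sub>C x) = 0" for c
  proof (rule cstar_nonneg_line)
    fix t
    show "cstar_nonneg (t *\<^sub>R (c *\<^sub>C x + star (c *\<^sub>C x)) + b)"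
      using ip_integral_nonneg[OF assms, of "of_real t * c"]
      by (simp add: scaleC_of_real star_scaleR scaleR_add_right flip: scaleC_scaleC)
  qed
  \<comment> \<open>Real multiples see only the selfadjoint part of \<open>c *\<^sub>C x\<close>.
    The choice \<open>c = 1\<close> gives \<open>star x = - x\<close> and \<open>c = \<i>\<close>
    gives \<open>star x = x\<close>, hence \<open>2 *\<^sub>R x = 0\<close>.\<close>
  have "star x = - x" using zero[of 1] by (simp add: eq_neg_iff_add_eq_0 add.commute)
  moreover have "\<i> *\<^sub>C (x - star x) = 0"
    using zero[of \<i>] by (simp add: star_scaleC scaleC_diff_right scaleC_minus_left)
  then have "norm (x - star x) = 0" using norm_scaleC[of \<i> "x - star x"] by simp
  ultimately show ?thesis by (simp flip: scaleR_2)
qed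


section \<open>Sums of frames\<close>

lemma op_family_mem:
  assumes "op_family \<nu> H K S \<Upsilon>" "h \<in> carrier H" "\<xi> \<in> space \<nu>"
  shows "\<Upsilon> \<xi> h \<in> S \<xi>"
  using assms endo_star_closed[of "\<Upsilon> \<xi>" H "submod K (S \<xi>)" h] by (auto simp: op_family_def)

theorem theorem3p1:
  fixes \<nu> :: "'w measure"
    and H :: "('a::cstar_algebra, 'h::real_normed_vector) cstar_mod"
    and K :: "('a, 'k::real_normed_vector) cstar_mod"
    and S :: "'w \<Rightarrow> 'k set"
    and K1 K2 :: "'h \<Rightarrow> 'h"
    and \<Upsilon> \<Phi> :: "'w \<Rightarrow> 'h \<Rightarrow> 'k"
  assumes "hilbert_module H" and "hilbert_module K"
    and "\<And>\<xi>. \<xi> \<in> space \<nu> \<Longrightarrow> closed_submodule (S \<xi>) K"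
    and "K1 \<in> endo_star H H" and "K2 \<in> endo_star H H"
    and "closed (K1 ` carrier H)" and "closed (K2 ` carrier H)"
    and "cKg_frame \<nu> H K S K1 \<Upsilon>" and "cg_bessel \<nu> H K S \<Phi>"
  shows "(positive_op H K1 \<and> cKg_dual \<nu> H K S K1 \<Upsilon> \<Phi> \<longrightarrow>
            cKg_frame \<nu> H K S K1 (\<lambda>\<xi> h. \<Upsilon> \<xi> h + \<Phi> \<xi> h)) \<and>
         (\<forall>T\<^sub>\<Upsilon> T\<^sub>\<Phi> T\<^sub>\<Phi>_adj.
            cKg_frame \<nu> H K S (\<lambda>h. K1 h + K2 h) \<Phi> \<and>
            synthesis_op \<nu> H K S \<Upsilon> T\<^sub>\<Upsilon> \<and>
            synthesis_op \<nu> H K S \<Phi> T\<^sub>\<Phi> \<and>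
            adjoint_pair (direct_sum \<nu> K S) H T\<^sub>\<Phi> T\<^sub>\<Phi>_adj \<and>
            (\<forall>g\<in>carrier H. T\<^sub>\<Upsilon> (T\<^sub>\<Phi>_adj g) = 0) \<longrightarrow>
            cKg_frame \<nu> H K S (\<lambda>h. K1 h + K2 h) (\<lambda>\<xi> h. \<Upsilon> \<xi> h + \<Phi> \<xi> h))"
proof -
  interpret H: hilbert_module H by (rule assms(1))
  interpret K: hilbert_module K by (rule assms(2))
  let ?I = "\<lambda>\<Psi> h. vec_integral \<nu> (\<lambda>\<xi>. \<langle>\<Psi> \<xi> h, \<Psi> \<xi> h\<rangle>\<^bsub>K\<^esub>)"
  have S: "S \<xi> \<subseteq> carrier K" if "\<xi> \<in> space \<nu>" for \<xi>
    using assms(3)[OF that] by (simp add: closed_submodule_def)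
  have S_diff: "x - y \<in> S \<xi>" if "\<xi> \<in> space \<nu>" "x \<in> S \<xi>" "y \<in> S \<xi>" for \<xi> x y
  proof -
    have "- y \<in> S \<xi>"
      using assms(3)[OF that(1)] that K.uminus_eq[of y] by (auto simp: closed_submodule_def)
    then have "x + - y \<in> S \<xi>" using assms(3)[OF that(1)] that unfolding closed_submodule_def by blast
    then show ?thesis by simp
  qed
  obtain A1 B1 where \<Upsilon>: "op_family \<nu> H K S \<Upsilon>" and AB1: "0 < A1" "A1 \<le> B1"
    and int\<Upsilon>: "\<And>h. h \<in> carrier H \<Longrightarrow> vec_integrable \<nu> (\<lambda>\<xi>. \<langle>\<Upsilon> \<xi> h, \<Upsilon> \<xi> h\<rangle>\<^bsub>K\<^esub>)"
    and lower\<Upsilon>: "\<And>h. h \<in> carrier H \<Longrightarrow> A1 *\<^sub>R \<langle>adj H H K1 h, adj H H K1 h\<rangle>\<^bsub>H\<^esub> \<preceq> ?I \<Upsilon> h"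
    and upper\<Upsilon>: "\<And>h. h \<in> carrier H \<Longrightarrow> ?I \<Upsilon> h \<preceq> B1 *\<^sub>R \<langle>h, h\<rangle>\<^bsub>H\<^esub>"
    using assms(8) unfolding cKg_frame_def by blast
  obtain B2 where \<Phi>: "op_family \<nu> H K S \<Phi>" and B2: "0 < B2"
    and int\<Phi>: "\<And>h. h \<in> carrier H \<Longrightarrow> vec_integrable \<nu> (\<lambda>\<xi>. \<langle>\<Phi> \<xi> h, \<Phi> \<xi> h\<rangle>\<^bsub>K\<^esub>)"
    and upper\<Phi>: "\<And>h. h \<in> carrier H \<Longrightarrow> ?I \<Phi> h \<preceq> B2 *\<^sub>R \<langle>h, h\<rangle>\<^bsub>H\<^esub>"
    using assms(9) unfolding cg_bessel_def by blast
  have mem\<Upsilon>: "\<Upsilon> \<xi> h \<in> S \<xi>" "\<Upsilon> \<xi> h \<in> carrier K"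
    and mem\<Phi>: "\<Phi> \<xi> h \<in> S \<xi>" "\<Phi> \<xi> h \<in> carrier K"
    if "h \<in> carrier H" "\<xi> \<in> space \<nu>" for h \<xi>
    using op_family_mem[OF \<Upsilon> that] op_family_mem[OF \<Phi> that] S[OF that(2)] by auto
  have adj_ip: "has_vec_integral \<nu> (\<lambda>\<xi>. \<langle>adj H (submod K (S \<xi>)) (\<Psi> \<xi>) (F \<xi>), h\<rangle>\<^bsub>H\<^esub>) x \<longleftrightarrow>
      has_vec_integral \<nu> (\<lambda>\<xi>. \<langle>F \<xi>, \<Psi> \<xi> h\<rangle>\<^bsub>K\<^esub>) x"
    if "op_family \<nu> H K S \<Psi>" "\<And>\<xi>. \<xi> \<in> space \<nu> \<Longrightarrow> F \<xi> \<in> S \<xi>" "h \<in> carrier H" for \<Psi> F h x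
    using that by (intro has_vec_integral_cong ip_adj_left[OF assms(1,2) S])
      (auto simp: op_family_def)
  \<comment> \<open>Common core of (i) and (ii): a nonnegative cross integral, and a lower bound for
    the two separate integrals added together.\<close>
  have frameI: "cKg_frame \<nu> H K S L (\<lambda>\<xi> h. \<Upsilon> \<xi> h + \<Phi> \<xi> h)"
    if cross: "\<And>h. h \<in> carrier H \<Longrightarrow> \<exists>x. has_vec_integral \<nu> (\<lambda>\<xi>. \<langle>\<Phi> \<xi> h, \<Upsilon> \<xi> h\<rangle>\<^bsub>K\<^esub>) x \<and> cstar_nonneg x"
      and A: "0 < A" and lower: "\<And>h. h \<in> carrier H \<Longrightarrow>
        cstar_nonneg (?I \<Upsilon> h + ?I \<Phi> h - A *\<^sub>R \<langle>adj H H L h, adj H H L h\<rangle>\<^bsub>H\<^esub>)"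
    for L A
    unfolding cKg_frame_def
  \<comment> \<open>The parallelogram law yields the upper constant \<open>2 * (B1 + B2)\<close>;
    adding \<open>A\<close> guarantees that it is at least the lower constant.\<close>
  proof (rule conjI, rule op_family_add[OF assms(1-3) \<Upsilon> \<Phi>], assumption,
      rule exI[of _ A], rule exI[of _ "A + 2 * (B1 + B2)"], intro conjI ballI)
    show "A \<le> A + 2 * (B1 + B2)" using AB1 B2 by simp
    fix h assume h: "h \<in> carrier H"
    obtain x where x: "has_vec_integral \<nu> (\<lambda>\<xi>. \<langle>\<Phi> \<xi> h, \<Upsilon> \<xi> h\<rangle>\<^bsub>K\<^esub>) x" "cstar_nonneg x"
      using cross[OF h] by blast
    have sx: "star x = x" by (rule cstar_nonneg_star[OF x(2)])
    note ints = mem\<Phi>(2)[OF h] mem\<Upsilon>(2)[OF h] has_vec_integral_vec_integral[OF int\<Phi>[OF h]] x(1)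
      has_vec_integral_vec_integral[OF int\<Upsilon>[OF h]]
    have "has_vec_integral \<nu> (\<lambda>\<xi>. \<langle>1 \<cdot>\<^bsub>K\<^esub> \<Phi> \<xi> h + \<Upsilon> \<xi> h, 1 \<cdot>\<^bsub>K\<^esub> \<Phi> \<xi> h + \<Upsilon> \<xi> h\<rangle>\<^bsub>K\<^esub>)
        (?I \<Phi> h + x + x + ?I \<Upsilon> h)"
      using K.has_vec_integral_ip_add_scaled[OF ints, of 1] by (simp add: sx)
    \<comment> \<open>That the unit acts as the identity is not an axiom of the locale; it comes
      from \<open>scaleR_act\<close> with the real scalar 1.\<close>
    moreover have "1 \<cdot>\<^bsub>K\<^esub> \<Phi> \<xi> h = \<Phi> \<xi> h" if "\<xi> \<in> space \<nu>" for \<xi>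
      using K.scaleR_act[OF mem\<Phi>(2)[OF h that], of 1] by simp
    ultimately have I: "has_vec_integral \<nu> (\<lambda>\<xi>. \<langle>\<Upsilon> \<xi> h + \<Phi> \<xi> h, \<Upsilon> \<xi> h + \<Phi> \<xi> h\<rangle>\<^bsub>K\<^esub>)
        (?I \<Phi> h + x + x + ?I \<Upsilon> h)"
      by (subst has_vec_integral_cong) (auto simp: add.commute)
    then show "vec_integrable \<nu> (\<lambda>\<xi>. \<langle>\<Upsilon> \<xi> h + \<Phi> \<xi> h, \<Upsilon> \<xi> h + \<Phi> \<xi> h\<rangle>\<^bsub>K\<^esub>)"
      by (auto simp: vec_integrable_def)
    have "cstar_nonneg (?I \<Upsilon> h + ?I \<Phi> h - A *\<^sub>R \<langle>adj H H L h, adj H H L h\<rangle>\<^bsub>H\<^esub> + (x + x))"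
      by (intro cstar_nonneg_add lower h x)
    then show "A *\<^sub>R \<langle>adj H H L h, adj H H L h\<rangle>\<^bsub>H\<^esub>
        \<preceq> vec_integral \<nu> (\<lambda>\<xi>. \<langle>\<Upsilon> \<xi> h + \<Phi> \<xi> h, \<Upsilon> \<xi> h + \<Phi> \<xi> h\<rangle>\<^bsub>K\<^esub>)"
      unfolding cstar_le_def vec_integral_eq[OF I] by (simp add: algebra_simps)
    have p: "cstar_nonneg (A *\<^sub>R \<langle>h, h\<rangle>\<^bsub>H\<^esub>)"
      using A by (intro cstar_nonneg_scaleR H.ip_self_nonneg h) simp
    \<comment> \<open>This is the integral of the square of the difference of the two families.
      Being nonnegative, it bounds the integral for the sum by twice the two separate
      integrals.\<close>
    have q: "cstar_nonneg (?I \<Phi> h - x - x + ?I \<Upsilon> h)"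
      using K.ip_integral_nonneg[OF ints, of "- 1"] by (simp add: sx scaleC_minus_left star_minus)
    have r: "cstar_nonneg (B1 *\<^sub>R \<langle>h, h\<rangle>\<^bsub>H\<^esub> - ?I \<Upsilon> h)" "cstar_nonneg (B2 *\<^sub>R \<langle>h, h\<rangle>\<^bsub>H\<^esub> - ?I \<Phi> h)"
      using upper\<Upsilon>[OF h] upper\<Phi>[OF h] by (simp_all add: cstar_le_def)
    have "cstar_nonneg (A *\<^sub>R \<langle>h, h\<rangle>\<^bsub>H\<^esub> + (?I \<Phi> h - x - x + ?I \<Upsilon> h)
        + 2 *\<^sub>R ((B1 *\<^sub>R \<langle>h, h\<rangle>\<^bsub>H\<^esub> - ?I \<Upsilon> h) + (B2 *\<^sub>R \<langle>h, h\<rangle>\<^bsub>H\<^esub> - ?I \<Phi> h)))"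
      by (rule cstar_nonneg_add[OF cstar_nonneg_add[OF p q] cstar_nonneg_scaleR[OF cstar_nonneg_add[OF r]]])
        simp
    moreover have "A *\<^sub>R \<langle>h, h\<rangle>\<^bsub>H\<^esub> + (?I \<Phi> h - x - x + ?I \<Upsilon> h)
        + 2 *\<^sub>R ((B1 *\<^sub>R \<langle>h, h\<rangle>\<^bsub>H\<^esub> - ?I \<Upsilon> h) + (B2 *\<^sub>R \<langle>h, h\<rangle>\<^bsub>H\<^esub> - ?I \<Phi> h))
      = (A + 2 * (B1 + B2)) *\<^sub>R \<langle>h, h\<rangle>\<^bsub>H\<^esub> - (?I \<Phi> h + x + x + ?I \<Upsilon> h)"
      by (simp add: algebra_simps scaleR_2)
    ultimately show "vec_integral \<nu> (\<lambda>\<xi>. \<langle>\<Upsilon> \<xi> h + \<Phi> \<xi> h, \<Upsilon> \<xi> h + \<Phi> \<xi> h\<rangle>\<^bsub>K\<^esub>)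
        \<preceq> (A + 2 * (B1 + B2)) *\<^sub>R \<langle>h, h\<rangle>\<^bsub>H\<^esub>"
      by (simp add: cstar_le_def vec_integral_eq[OF I])
  qed (rule A)
  have nonneg: "cstar_nonneg (?I \<Upsilon> h)" "cstar_nonneg (?I \<Phi> h)" if h: "h \<in> carrier H" for h
    by (rule has_vec_integral_cstar_nonneg[OF has_vec_integral_vec_integral[OF int\<Upsilon>[OF h]]],
        simp add: K.ip_self_nonneg mem\<Upsilon> h)
      (rule has_vec_integral_cstar_nonneg[OF has_vec_integral_vec_integral[OF int\<Phi>[OF h]]],
        simp add: K.ip_self_nonneg mem\<Phi> h)
  show ?thesis
  proof (intro conjI impI allI)
    assume a: "positive_op H K1 \<and> cKg_dual \<nu> H K S K1 \<Upsilon> \<Phi>"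
    show "cKg_frame \<nu> H K S K1 (\<lambda>\<xi> h. \<Upsilon> \<xi> h + \<Phi> \<xi> h)"
    proof (rule frameI[OF _ AB1(1)])
      fix h assume h: "h \<in> carrier H"
      have "has_vec_integral \<nu> (\<lambda>\<xi>. \<langle>adj H (submod K (S \<xi>)) (\<Upsilon> \<xi>) (\<Phi> \<xi> h), h\<rangle>\<^bsub>H\<^esub>) \<langle>K1 h, h\<rangle>\<^bsub>H\<^esub>"
        using a h unfolding cKg_dual_def by blast
      then have "has_vec_integral \<nu> (\<lambda>\<xi>. \<langle>\<Phi> \<xi> h, \<Upsilon> \<xi> h\<rangle>\<^bsub>K\<^esub>) \<langle>K1 h, h\<rangle>\<^bsub>H\<^esub>"
        using adj_ip[OF \<Upsilon> mem\<Phi>(1)[OF h] h] by blast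
      moreover have "cstar_nonneg \<langle>K1 h, h\<rangle>\<^bsub>H\<^esub>"
        using a h by (simp add: positive_op_def cstar_le_def)
      ultimately show "\<exists>x. has_vec_integral \<nu> (\<lambda>\<xi>. \<langle>\<Phi> \<xi> h, \<Upsilon> \<xi> h\<rangle>\<^bsub>K\<^esub>) x \<and> cstar_nonneg x" by blast
      have "cstar_nonneg ((?I \<Upsilon> h - A1 *\<^sub>R \<langle>adj H H K1 h, adj H H K1 h\<rangle>\<^bsub>H\<^esub>) + ?I \<Phi> h)"
        using lower\<Upsilon>[OF h] nonneg(2)[OF h] by (intro cstar_nonneg_add) (simp_all add: cstar_le_def)
      then show "cstar_nonneg (?I \<Upsilon> h + ?I \<Phi> h - A1 *\<^sub>R \<langle>adj H H K1 h, adj H H K1 h\<rangle>\<^bsub>H\<^esub>)"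
        by (simp add: algebra_simps)
    qed
  next
    fix T\<^sub>\<Upsilon> T\<^sub>\<Phi> T\<^sub>\<Phi>_adj
    let ?L = "\<lambda>h. K1 h + K2 h" and ?DS = "direct_sum \<nu> K S"
    assume a: "cKg_frame \<nu> H K S ?L \<Phi> \<and> synthesis_op \<nu> H K S \<Upsilon> T\<^sub>\<Upsilon> \<and> synthesis_op \<nu> H K S \<Phi> T\<^sub>\<Phi> \<and>
      adjoint_pair ?DS H T\<^sub>\<Phi> T\<^sub>\<Phi>_adj \<and> (\<forall>g\<in>carrier H. T\<^sub>\<Upsilon> (T\<^sub>\<Phi>_adj g) = 0)"
    obtain A where A: "0 < A"
      "\<And>h. h \<in> carrier H \<Longrightarrow> A *\<^sub>R \<langle>adj H H ?L h, adj H H ?L h\<rangle>\<^bsub>H\<^esub> \<preceq> ?I \<Phi> h"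
      using a unfolding cKg_frame_def by blast
    have DS_mem: "F \<xi> \<in> S \<xi>" "F \<xi> \<in> carrier K" if "F \<in> carrier ?DS" "\<xi> \<in> space \<nu>" for F \<xi>
      using that S by (auto simp: direct_sum_def)
    have syn: "has_vec_integral \<nu> (\<lambda>\<xi>. \<langle>F \<xi>, \<Psi> \<xi> g\<rangle>\<^bsub>K\<^esub>) \<langle>T F, g\<rangle>\<^bsub>H\<^esub>"
      if "op_family \<nu> H K S \<Psi>" "synthesis_op \<nu> H K S \<Psi> T" "F \<in> carrier ?DS" "g \<in> carrier H" for \<Psi> T F g
    proof (rule adj_ip[THEN iffD1])
      show "has_vec_integral \<nu> (\<lambda>\<xi>. \<langle>adj H (submod K (S \<xi>)) (\<Psi> \<xi>) (F \<xi>), g\<rangle>\<^bsub>H\<^esub>) \<langle>T F, g\<rangle>\<^bsub>H\<^esub>"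
        using that unfolding synthesis_op_def by blast
    qed (use that DS_mem in auto)
    note syn\<Upsilon> = syn[OF \<Upsilon> a[THEN conjunct2, THEN conjunct1]]
      and syn\<Phi> = syn[OF \<Phi> a[THEN conjunct2, THEN conjunct2, THEN conjunct1]]
    have "has_vec_integral \<nu> (\<lambda>\<xi>. \<langle>\<Phi> \<xi> g, \<Upsilon> \<xi> g\<rangle>\<^bsub>K\<^esub>) 0" if g: "g \<in> carrier H" for g
    proof -
      define F where "F = T\<^sub>\<Phi>_adj g"
      define G where "G = (\<lambda>\<xi>. \<Phi> \<xi> g)"
      define D where "D = (\<lambda>\<xi>. F \<xi> - G \<xi>)"
      have F: "F \<in> carrier ?DS" using a g by (auto simp: F_def adjoint_pair_def)
      have G: "G \<in> carrier ?DS"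
        using mem\<Phi>(1)[OF g] int\<Phi>[OF g] \<Phi> g by (auto simp: G_def direct_sum_def op_family_def)
      have FF: "has_vec_integral \<nu> (\<lambda>\<xi>. \<langle>F \<xi>, F \<xi>\<rangle>\<^bsub>K\<^esub>) (vec_integral \<nu> (\<lambda>\<xi>. \<langle>F \<xi>, F \<xi>\<rangle>\<^bsub>K\<^esub>))"
        using F by (intro has_vec_integral_vec_integral) (simp add: direct_sum_def)
      have FG: "has_vec_integral \<nu> (\<lambda>\<xi>. \<langle>F \<xi>, G \<xi>\<rangle>\<^bsub>K\<^esub>) \<langle>T\<^sub>\<Phi> F, g\<rangle>\<^bsub>H\<^esub>"
        and GG: "has_vec_integral \<nu> (\<lambda>\<xi>. \<langle>G \<xi>, G \<xi>\<rangle>\<^bsub>K\<^esub>) \<langle>T\<^sub>\<Phi> G, g\<rangle>\<^bsub>H\<^esub>"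
        using syn\<Phi>[OF F g] syn\<Phi>[OF G g] by (simp_all add: G_def)
      \<comment> \<open>\<open>adjoint_pair\<close> speaks only of \<open>vec_integral\<close>,
        which carries information only once an integral is known to exist; here it exists by
        swapping the arguments in \<open>FG\<close>.\<close>
      have GF: "has_vec_integral \<nu> (\<lambda>\<xi>. \<langle>G \<xi>, F \<xi>\<rangle>\<^bsub>K\<^esub>) (star \<langle>T\<^sub>\<Phi> F, g\<rangle>\<^bsub>H\<^esub>)"
        by (rule K.has_vec_integral_ip_swap[OF DS_mem(2)[OF F] DS_mem(2)[OF G] FG])
      have adj: "vec_integral \<nu> (\<lambda>\<xi>. \<langle>X \<xi>, F \<xi>\<rangle>\<^bsub>K\<^esub>) = \<langle>T\<^sub>\<Phi> X, g\<rangle>\<^bsub>H\<^esub>" if "X \<in> carrier ?DS" for X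
        using a g that by (simp add: adjoint_pair_def F_def direct_sum_def)
      have FF': "has_vec_integral \<nu> (\<lambda>\<xi>. \<langle>F \<xi>, F \<xi>\<rangle>\<^bsub>K\<^esub>) \<langle>T\<^sub>\<Phi> F, g\<rangle>\<^bsub>H\<^esub>"
        using FF adj[OF F] by simp
      have GF': "has_vec_integral \<nu> (\<lambda>\<xi>. \<langle>G \<xi>, F \<xi>\<rangle>\<^bsub>K\<^esub>) \<langle>T\<^sub>\<Phi> G, g\<rangle>\<^bsub>H\<^esub>"
        using GF adj[OF G] vec_integral_eq[OF GF] by simp
      \<comment> \<open>For \<open>X\<close> equal to \<open>F\<close> or \<open>G\<close>,
        adjointness evaluates the pairing of \<open>X\<close> with \<open>F\<close>, and the weak
        formula that of \<open>X\<close> with \<open>G\<close>, to the same element. So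
        \<open>D\<close> is orthogonal to both and is a null vector.\<close>
      have "has_vec_integral \<nu> (\<lambda>\<xi>. (\<langle>F \<xi>, F \<xi>\<rangle>\<^bsub>K\<^esub> - \<langle>F \<xi>, G \<xi>\<rangle>\<^bsub>K\<^esub>) - (\<langle>G \<xi>, F \<xi>\<rangle>\<^bsub>K\<^esub> - \<langle>G \<xi>, G \<xi>\<rangle>\<^bsub>K\<^esub>))
          ((\<langle>T\<^sub>\<Phi> F, g\<rangle>\<^bsub>H\<^esub> - \<langle>T\<^sub>\<Phi> F, g\<rangle>\<^bsub>H\<^esub>) - (\<langle>T\<^sub>\<Phi> G, g\<rangle>\<^bsub>H\<^esub> - \<langle>T\<^sub>\<Phi> G, g\<rangle>\<^bsub>H\<^esub>))"
        by (rule has_vec_integral_diff[OF has_vec_integral_diff[OF FF' FG]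
              has_vec_integral_diff[OF GF' GG]])
      moreover have "\<langle>D \<xi>, D \<xi>\<rangle>\<^bsub>K\<^esub>
          = (\<langle>F \<xi>, F \<xi>\<rangle>\<^bsub>K\<^esub> - \<langle>F \<xi>, G \<xi>\<rangle>\<^bsub>K\<^esub>) - (\<langle>G \<xi>, F \<xi>\<rangle>\<^bsub>K\<^esub> - \<langle>G \<xi>, G \<xi>\<rangle>\<^bsub>K\<^esub>)" if "\<xi> \<in> space \<nu>" for \<xi>
        using DS_mem(2)[OF F that] DS_mem(2)[OF G that]
        by (simp add: D_def K.ip_diff_left K.ip_diff_right K.diff_closed)
      ultimately have DD: "has_vec_integral \<nu> (\<lambda>\<xi>. \<langle>D \<xi>, D \<xi>\<rangle>\<^bsub>K\<^esub>) 0"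
        by (subst has_vec_integral_cong) auto
      have D_mem: "D \<xi> \<in> carrier K" if "\<xi> \<in> space \<nu>" for \<xi>
        using DS_mem(2)[OF F that] DS_mem(2)[OF G that] by (simp add: D_def K.diff_closed)
      have "D \<xi> \<in> S \<xi>" if "\<xi> \<in> space \<nu>" for \<xi>
        using DS_mem(1)[OF F that] DS_mem(1)[OF G that] that by (simp add: D_def S_diff)
      moreover have "strongly_measurable \<nu> D"
        using F G unfolding D_def by (intro strongly_measurable_diff) (auto simp: direct_sum_def)
      ultimately have D: "D \<in> carrier ?DS"
        using DD by (auto simp: direct_sum_def vec_integrable_def)
      \<comment> \<open>Membership of \<open>D\<close> in the direct sum lets the weak formula for
        \<open>T\<^sub>\<Upsilon>\<close> supply an integral of this pairing; the null vector
        argument then identifies its value as 0.\<close>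
      have D\<Upsilon>: "has_vec_integral \<nu> (\<lambda>\<xi>. \<langle>D \<xi>, \<Upsilon> \<xi> g\<rangle>\<^bsub>K\<^esub>) 0"
        using syn\<Upsilon>[OF D g] K.null_ip_integral[OF D_mem mem\<Upsilon>(2)[OF g] DD syn\<Upsilon>[OF D g]
            has_vec_integral_vec_integral[OF int\<Upsilon>[OF g]]] by simp
      have "T\<^sub>\<Upsilon> F = 0" using a g by (simp add: F_def)
      moreover have "\<langle>0, g\<rangle>\<^bsub>H\<^esub> = 0" using H.ip_diff_left[of g g g] g by simp
      ultimately have "has_vec_integral \<nu> (\<lambda>\<xi>. \<langle>F \<xi>, \<Upsilon> \<xi> g\<rangle>\<^bsub>K\<^esub>) 0"
        using syn\<Upsilon>[OF F g] by simp
      from has_vec_integral_diff[OF this D\<Upsilon>]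
      have "has_vec_integral \<nu> (\<lambda>\<xi>. \<langle>F \<xi>, \<Upsilon> \<xi> g\<rangle>\<^bsub>K\<^esub> - \<langle>D \<xi>, \<Upsilon> \<xi> g\<rangle>\<^bsub>K\<^esub>) 0" by simp
      moreover have "\<langle>\<Phi> \<xi> g, \<Upsilon> \<xi> g\<rangle>\<^bsub>K\<^esub> = \<langle>F \<xi>, \<Upsilon> \<xi> g\<rangle>\<^bsub>K\<^esub> - \<langle>D \<xi>, \<Upsilon> \<xi> g\<rangle>\<^bsub>K\<^esub>" if "\<xi> \<in> space \<nu>" for \<xi>
        using DS_mem(2)[OF F that] DS_mem(2)[OF G that] mem\<Upsilon>(2)[OF g that]
        by (simp add: D_def K.ip_diff_left) (simp add: G_def)
      ultimately show ?thesis by (subst has_vec_integral_cong) auto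
    qed
    note cross = this
    show "cKg_frame \<nu> H K S ?L (\<lambda>\<xi> h. \<Upsilon> \<xi> h + \<Phi> \<xi> h)"
    proof (rule frameI[OF _ A(1)])
      fix h assume h: "h \<in> carrier H"
      show "\<exists>x. has_vec_integral \<nu> (\<lambda>\<xi>. \<langle>\<Phi> \<xi> h, \<Upsilon> \<xi> h\<rangle>\<^bsub>K\<^esub>) x \<and> cstar_nonneg x"
        using cross[OF h] cstar_nonneg_zero by blast
      have "cstar_nonneg (?I \<Upsilon> h + (?I \<Phi> h - A *\<^sub>R \<langle>adj H H ?L h, adj H H ?L h\<rangle>\<^bsub>H\<^esub>))"
        using A(2)[OF h] nonneg(1)[OF h] by (intro cstar_nonneg_add) (simp_all add: cstar_le_def)
      then show "cstar_nonneg (?I \<Upsilon> h + ?I \<Phi> h - A *\<^sub>R \<langle>adj H H ?L h, adj H H ?L h\<rangle>\<^bsub>H\<^esub>)"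
        by (simp add: algebra_simps)
    qed
  qed
qed

end
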